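(* Let $1\le n<N$ be integers and let $K\subset\mathbb{R}^N$ be a convex body containing the origin in its interior. Then for every linear subspace $F\subset\mathbb{R}^N$ of dimension $n+1$ and for every $s\ge1$, $$\mathcal{R}_n(K)\ge\frac{\sqrt n}{4\,s\,\ell(K\cap F)}$$ with probability at least $$1-e^{-n/8}-\exp\left(-\frac{s^2\,\ell(K\cap F)^2}{2\,b_{K\cap F}^2}\right).$$
   Context: $|\cdot|$ is the Euclidean norm. A convex body is a compact convex set containing the origin in its interior (not necessarily symmetric). $K\cap F$ is regarded as a convex body in the Euclidean space $F$. For a convex body $L$ in a Euclidean space $H$: $\|x\|_L=\inf\{\lambda>0:x\in\lambda L\}$, $\ell(L)=\mathbb{E}\|G\|_L$ with $G$ a standard Gaussian vector in $H$, and $b_L=\max\{\|x\|_L: x\in H,\ |x|=1\}$. The $n$-th random radius is the random variable $\mathcal{R}_n(K)=\max_{y\in E_n\cap K}|y|$, where $E_n$ is a random $n$-codimensional linear subspace of $\mathbb{R}^N$ distributed according to the normalized Haar measure on the Grassmannian. Probability is with respect to $E_n$. *)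

theory Defs
  imports "HOL-Analysis.Analysis" "HOL-Probability.Probability"
begin

section \<open>Convex bodies in a Euclidean space\<close>

definition convex_body :: "'a::euclidean_space set \<Rightarrow> bool" where
  "convex_body K \<longleftrightarrow> compact K \<and> convex K \<and> 0 \<in> interior K"

definition gauge_norm :: "'a::euclidean_space set \<Rightarrow> 'a \<Rightarrow> real" where
  "gauge_norm L x = Inf {r. 0 < r \<and> x \<in> (\<lambda>y. r *\<^sub>R y) ` L}"

text \<open>
  A Euclidean space is a linear subspace H of an ambient one, with the induced inner product. Its
  standard Gaussian measure is the law of a sum of g(b) b over an orthonormal basis of H, with
  independent standard normal coefficients g(b); by rotation invariance the chosen basis is
  immaterial. The measure lives on the ambient Borel sets and is concentrated on H.
\<close>

definition orthonormal_basis_of :: "'a::euclidean_space set \<Rightarrow> 'a set \<Rightarrow> bool" where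
  "orthonormal_basis_of H B \<longleftrightarrow>
     pairwise orthogonal B \<and> (\<forall>b\<in>B. norm b = 1) \<and> span B = H"

definition std_gaussian :: "'a::euclidean_space set \<Rightarrow> 'a measure" where
  "std_gaussian H =
     (let B = (SOME B. orthonormal_basis_of H B)
      in distr (\<Pi>\<^sub>M b\<in>B. density lborel (\<lambda>x. ennreal (std_normal_density x))) borel
               (\<lambda>g. \<Sum>b\<in>B. g b *\<^sub>R b))"

text \<open>In the next two definitions L is a convex body relative to H.\<close>

definition ell :: "'a::euclidean_space set \<Rightarrow> 'a set \<Rightarrow> real" where
  "ell H L = (\<integral>x. gauge_norm L x \<partial>std_gaussian H)"

text \<open>The supremum is a maximum: the gauge is continuous on the unit sphere of H.\<close>

definition b_const :: "'a::euclidean_space set \<Rightarrow> 'a set \<Rightarrow> real" where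
  "b_const H L = (SUP x\<in>{x\<in>H. norm x = 1}. gauge_norm L x)"

section \<open>The Grassmannian and its normalized Haar measure\<close>

definition grassmannian :: "nat \<Rightarrow> 'a::euclidean_space set set" where
  "grassmannian k = {E. subspace E \<and> dim E = k}"

text \<open>
  The usual topology on the Grassmannian, obtained by identifying a subspace with the matrix of its
  orthogonal projection; on a linear subspace, the latter is the nearest-point map.
\<close>

definition grassmannian_topology :: "nat \<Rightarrow> (real^'n) set topology" where
  "grassmannian_topology k =
     pullback_topology (grassmannian k) (\<lambda>E. matrix (closest_point E)) euclidean"

definition grassmannian_borel :: "nat \<Rightarrow> (real^'n) set measure" where
  "grassmannian_borel k = sigma (grassmannian k) {U. openin (grassmannian_topology k) U}"

text \<open>
  The normalized Haar measure is the unique Borel probability measure on the Grassmannian that is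
  invariant under the action of the orthogonal group.
\<close>

definition haar_grassmannian :: "nat \<Rightarrow> (real^'n) set measure \<Rightarrow> bool" where
  "haar_grassmannian k \<mu> \<longleftrightarrow>
     prob_space \<mu> \<and> sets \<mu> = sets (grassmannian_borel k) \<and>
     (\<forall>T. orthogonal_transformation T \<longrightarrow> distr \<mu> (grassmannian_borel k) (\<lambda>E. T ` E) = \<mu>)"

text \<open>The radius of the section of K by E. For a convex body K the supremum is a maximum.\<close>

definition section_radius :: "'a::euclidean_space set \<Rightarrow> 'a set \<Rightarrow> real" where
  "section_radius K E = (SUP y\<in>E \<inter> K. norm y)"

end

theory Submission
  imports Defs
begin

text \<open>
  Let P be the orthogonal projection onto F, let L = K \<inter> F, and let G be a standard Gaussian vector of
  the whole space; then P G is a standard Gaussian vector of F. Since dim E + dim F > N, a random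
  subspace E contains a line of F, and rotation invariance suggests that a direction in \<open>E \<inter> F\<close> can be
  chosen with the law of the direction of P G. A vector w of \<open>E \<inter> F\<close> with gauge \<open>g(w)\<close> has a multiple in
  \<open>E \<inter> K\<close> of norm \<open>|w| / g(w)\<close>. So the radius exceeds \<rho> as soon as \<open>|P G| > \<rho> g(P G)\<close>, and two Gaussian
  estimates finish the proof: \<open>|P G|\<close> is rarely much smaller than sqrt n, and \<open>g(P G)\<close> is rarely much
  larger than its mean \<open>ell(L)\<close>.

  The comparison of E with G is \<open>haar_grassmannian_ge_gaussian\<close>. It couples E with G so that P G makes
  a small angle \<delta> with E, using only the invariance of the two laws and reflections that preserve F.
  The error caused by \<delta> is repaired by \<open>section_radius_ge_of_close_point\<close>, at the cost of a factor
  close to 1.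

  The lower estimate is \<open>gaussian_small_ball\<close>. The upper estimate is \<open>gaussian_sublinear_tail\<close>: for a
  sublinear function with Lipschitz constant b, an excess u over the mean has probability at most
  \<open>exp (- 2 u\<^sup>2 / (pi\<^sup>2 b\<^sup>2))\<close>. It comes from a discrete Maurey-Pisier argument, which rotates one Gaussian
  vector into an independent copy and bounds the increments of the function along the path by linear
  functionals of the velocity; subgradients take the place of derivatives.

  The constant \<open>2 / pi\<^sup>2\<close> is worse than the constant 1/2 in the claimed bound, but the factor 4 in the
  radius leaves room for it. Split at \<open>|P G| = 0.645 sqrt n\<close>. Then a failure means either that \<open>|P G|\<close> is
  smaller, which has probability at most \<open>exp (- n / 8)\<close>, or that \<open>g(P G)\<close> exceeds nearly
  \<open>4 * 0.645 s ell(L) = 2.58 s ell(L)\<close>, so certainly \<open>2.575 s ell(L)\<close>. As \<open>s \<ge> 1\<close> and \<open>1.575 > pi / 2\<close>, the excess over the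
  mean is more than \<open>(pi / 2) s ell(L)\<close>, and the tail bound becomes \<open>exp (- s\<^sup>2 ell(L)\<^sup>2 / (2 b\<^sup>2))\<close>.
\<close>

section \<open>The standard Gaussian measure\<close>

lemma nn_integral_lborel_translate:
  fixes a :: "'a::euclidean_space"
  assumes [measurable]: "h \<in> borel_measurable borel"
  shows "(\<integral>\<^sup>+x. h (x + a) \<partial>lborel) = (\<integral>\<^sup>+x. h x \<partial>lborel)"
proof -
  have "(\<integral>\<^sup>+x. h x \<partial>lborel) = (\<integral>\<^sup>+x. h x \<partial>distr lborel borel ((+) a))"
    by (simp add: lborel_distr_plus)
  also have "\<dots> = (\<integral>\<^sup>+x. h (x + a) \<partial>lborel)"
    by (subst nn_integral_distr) (simp_all add: add.commute)
  finally show ?thesis by simp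
qed

text \<open>
  The measures \<open>\<integral> g (T x) dx\<close> and \<open>\<integral> g x dx\<close> are both translation invariant. Testing them against
  the indicator f of the unit ball, which T and the reflection at 0 preserve, and exchanging the
  integrals over x and y in \<open>f (T x) * g (T x + y)\<close> shows that they differ by the factor
  \<open>\<integral> f / \<integral> f\<close>, that is, not at all.
\<close>

lemma nn_integral_lborel_orthogonal:
  fixes T :: "'a::euclidean_space \<Rightarrow> 'a"
  assumes T: "orthogonal_transformation T" and g [measurable]: "g \<in> borel_measurable borel"
  shows "(\<integral>\<^sup>+x. g (T x) \<partial>lborel) = (\<integral>\<^sup>+x. g x \<partial>lborel)"
proof -
  define f :: "'a \<Rightarrow> ennreal" where "f = indicator (ball 0 1)"
  define c where "c = (\<integral>\<^sup>+x. f x \<partial>lborel)"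
  have f [measurable]: "f \<in> borel_measurable borel"
    unfolding f_def by (intro borel_measurable_indicator) simp
  have "linear T" using T by (simp add: orthogonal_transformation_def)
  then have T_meas [measurable]: "T \<in> borel_measurable borel"
    by (intro borel_measurable_continuous_onI linear_continuous_on) (simp add: linear_conv_bounded_linear)
  have fT: "f (T x) = f x" and f_minus: "f (x - y) = f (y - x)" for x y
    using orthogonal_transformation_norm[OF T] by (simp_all add: f_def indicator_def norm_minus_commute)
  have "c = emeasure lborel (ball (0::'a) 1)"
    by (simp add: c_def f_def)
  then have c: "c \<noteq> 0" "c \<noteq> \<infinity>"
    using emeasure_lborel_ball_finite[of "0::'a" 1] open_not_negligible[of "ball (0::'a) 1"]
    by (auto simp: less_top[symmetric] negligible_iff_emeasure0)
  have T_shift: "(\<integral>\<^sup>+x. h (T x + y) \<partial>lborel) = (\<integral>\<^sup>+x. h (T x) \<partial>lborel)"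
    if [measurable]: "h \<in> borel_measurable borel" for h :: "'a \<Rightarrow> ennreal" and y
  proof -
    obtain z where "y = T z"
      using orthogonal_transformation_surj[OF T] by (metis surjD)
    then have "(\<integral>\<^sup>+x. h (T x + y) \<partial>lborel) = (\<integral>\<^sup>+x. h (T (x + z)) \<partial>lborel)"
      by (simp add: linear_add[OF \<open>linear T\<close>])
    also have "\<dots> = (\<integral>\<^sup>+x. h (T x) \<partial>lborel)"
      by (rule nn_integral_lborel_translate) measurable
    finally show ?thesis .
  qed
  have "c * (\<integral>\<^sup>+y. g y \<partial>lborel) = (\<integral>\<^sup>+x. f (T x) * (\<integral>\<^sup>+y. g y \<partial>lborel) \<partial>lborel)"
    by (simp add: fT c_def nn_integral_multc)
  also have "\<dots> = (\<integral>\<^sup>+x. f (T x) * (\<integral>\<^sup>+y. g (y + T x) \<partial>lborel) \<partial>lborel)"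
    by (simp add: nn_integral_lborel_translate)
  also have "\<dots> = (\<integral>\<^sup>+x. (\<integral>\<^sup>+y. f (T x) * g (T x + y) \<partial>lborel) \<partial>lborel)"
    by (simp add: nn_integral_cmult add.commute)
  also have "\<dots> = (\<integral>\<^sup>+y. (\<integral>\<^sup>+x. f (T x) * g (T x + y) \<partial>lborel) \<partial>lborel)"
    by (rule lborel_pair.Fubini') measurable
  also have "\<dots> = (\<integral>\<^sup>+y. (\<integral>\<^sup>+x. f (y - T x) * g (T x) \<partial>lborel) \<partial>lborel)"
    using T_shift[of "\<lambda>z. f (z - y) * g z" y for y] by (simp add: f_minus)
  also have "\<dots> = (\<integral>\<^sup>+x. (\<integral>\<^sup>+y. f (y - T x) * g (T x) \<partial>lborel) \<partial>lborel)"
    by (rule lborel_pair.Fubini') measurable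
  also have "\<dots> = (\<integral>\<^sup>+x. c * g (T x) \<partial>lborel)"
    using nn_integral_lborel_translate[OF f, of "- a" for a] by (simp add: nn_integral_multc c_def)
  also have "\<dots> = c * (\<integral>\<^sup>+x. g (T x) \<partial>lborel)"
    by (simp add: nn_integral_cmult)
  finally show ?thesis
    using c by (simp add: ennreal_mult_cancel_left)
qed

definition gaussian_density :: "'a::euclidean_space \<Rightarrow> real" where
  "gaussian_density x = (1 / sqrt (2 * pi)) ^ DIM('a) * exp (- (norm x)\<^sup>2 / 2)"

text \<open>
  A density with respect to Lebesgue measure makes the rotation invariance visible; the law of
  coordinates in an orthonormal basis is recovered in \<open>std_gaussian_eq_distr\<close>.
\<close>

definition gaussian :: "'a::euclidean_space measure" where
  "gaussian = density lborel (\<lambda>x. ennreal (gaussian_density x))"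

lemma gaussian_density_measurable [measurable]: "gaussian_density \<in> borel_measurable borel"
  unfolding gaussian_density_def by measurable

lemma gaussian_density_pos: "0 < gaussian_density x"
  by (simp add: gaussian_density_def)

lemma sets_gaussian [measurable_cong, simp]: "sets gaussian = sets borel"
  by (simp add: gaussian_def)

lemma space_gaussian [simp]: "space gaussian = UNIV"
  by (simp add: gaussian_def)

lemma gaussian_density_eq_prod:
  "gaussian_density (x::'a::euclidean_space) = (\<Prod>b\<in>Basis. std_normal_density (x \<bullet> b))"
proof -
  have "(norm x)\<^sup>2 / 2 = (\<Sum>b\<in>Basis. (x \<bullet> b)\<^sup>2 / 2)"
    unfolding power2_norm_eq_inner by (subst euclidean_inner) (simp add: power2_eq_square sum_divide_distrib)
  then have "exp (- (norm x)\<^sup>2 / 2) = (\<Prod>b\<in>Basis. exp (- (x \<bullet> b)\<^sup>2 / 2))"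
    by (simp add: exp_sum[symmetric] sum_negf)
  then show ?thesis
    by (simp only: gaussian_density_def std_normal_density_def prod.distrib prod_constant)
qed

lemma nn_integral_gaussian:
  assumes [measurable]: "g \<in> borel_measurable borel"
  shows "(\<integral>\<^sup>+x. g x \<partial>gaussian) = (\<integral>\<^sup>+x. ennreal (gaussian_density x) * g x \<partial>lborel)"
  unfolding gaussian_def by (rule nn_integral_density) auto

lemma nn_integral_gaussian_Basis:
  fixes f :: "'a::euclidean_space \<Rightarrow> real \<Rightarrow> ennreal"
  assumes [measurable]: "\<And>b. b \<in> Basis \<Longrightarrow> f b \<in> borel_measurable borel"
  shows "(\<integral>\<^sup>+x. (\<Prod>b\<in>Basis. f b (x \<bullet> b)) \<partial>gaussian)
    = (\<Prod>b\<in>Basis. \<integral>\<^sup>+t. f b t \<partial>density lborel std_normal_density)"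
proof -
  have "(\<integral>\<^sup>+x. (\<Prod>b\<in>Basis. f b (x \<bullet> b)) \<partial>gaussian)
    = (\<integral>\<^sup>+x. (\<Prod>b\<in>Basis. ennreal (std_normal_density (x \<bullet> b)) * f b (x \<bullet> b)) \<partial>lborel)"
    by (subst nn_integral_gaussian)
       (simp_all add: gaussian_density_eq_prod prod_ennreal prod.distrib)
  also have "\<dots> = (\<Prod>b\<in>Basis. \<integral>\<^sup>+t. ennreal (std_normal_density t) * f b t \<partial>lborel)"
    by (rule nn_integral_lborel_prod) auto
  finally show ?thesis
    by (simp add: nn_integral_density)
qed

lemma prob_space_std_normal: "prob_space (density lborel (\<lambda>x. ennreal (std_normal_density x)))"
  by (rule prob_space_normal_density) simp

lemma prob_space_gaussian: "prob_space (gaussian :: 'a::euclidean_space measure)"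
proof
  have "emeasure (gaussian :: 'a measure) UNIV = (\<integral>\<^sup>+x. (\<Prod>b\<in>(Basis::'a set). 1) \<partial>(gaussian :: 'a measure))"
    by simp
  also have "\<dots> = 1"
    using prob_space.emeasure_space_1[OF prob_space_std_normal]
    by (subst nn_integral_gaussian_Basis) (simp_all)
  finally show "emeasure (gaussian :: 'a measure) (space gaussian) = 1" by simp
qed

interpretation gaussian: prob_space gaussian
  by (rule prob_space_gaussian)

lemma linear_borel_measurable: "linear T \<Longrightarrow> (T :: 'a::euclidean_space \<Rightarrow> 'b::euclidean_space) \<in> borel_measurable borel"
  by (intro borel_measurable_continuous_onI linear_continuous_on) (simp add: linear_conv_bounded_linear)

lemma nn_integral_gaussian_orthogonal:
  fixes T :: "'a::euclidean_space \<Rightarrow> 'a"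
  assumes T: "orthogonal_transformation T" and [measurable]: "g \<in> borel_measurable borel"
  shows "(\<integral>\<^sup>+x. g (T x) \<partial>gaussian) = (\<integral>\<^sup>+x. g x \<partial>gaussian)"
proof -
  have [measurable]: "T \<in> borel_measurable borel"
    using T by (simp add: orthogonal_transformation_def linear_borel_measurable)
  have "gaussian_density (T x) = gaussian_density x" for x
    using orthogonal_transformation_norm[OF T] by (simp add: gaussian_density_def)
  then show ?thesis
    using nn_integral_lborel_orthogonal[OF T, of "\<lambda>x. gaussian_density x * g x"]
    by (simp add: nn_integral_gaussian)
qed

lemma gaussian_pair_eq:
  "gaussian \<Otimes>\<^sub>M gaussian = (gaussian :: ('a::euclidean_space \<times> 'b::euclidean_space) measure)"
proof -
  have [simp]: "gaussian_density (x :: 'a) * gaussian_density (y :: 'b) = gaussian_density (x, y)" for x y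
    by (simp add: gaussian_density_def power_add norm_prod_def exp_add[symmetric] add_divide_distrib)
  have "sigma_finite_measure (gaussian :: 'b measure)"
    by (simp add: prob_space_gaussian prob_space_imp_sigma_finite)
  then have "(gaussian :: 'a measure) \<Otimes>\<^sub>M (gaussian :: 'b measure)
    = density (lborel \<Otimes>\<^sub>M lborel) (\<lambda>(x, y). ennreal (gaussian_density x) * ennreal (gaussian_density y))"
    unfolding gaussian_def
    by (intro pair_measure_density) (auto simp: sigma_finite_lborel)
  also have "\<dots> = gaussian"
    unfolding lborel_prod gaussian_def
    by (simp add: ennreal_mult[symmetric] gaussian_density_pos less_imp_le case_prod_beta')
  finally show ?thesis .
qed

text \<open>
  The pair (c X + s Y, c Y - s X) has the law of (X, Y): two independent Gaussian vectors form one
  Gaussian vector of the product space, on which this map is orthogonal.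
\<close>

lemma nn_integral_gaussian_rotation:
  fixes h :: "'a::euclidean_space \<Rightarrow> 'a \<Rightarrow> ennreal"
  assumes [measurable]: "case_prod h \<in> borel_measurable (borel \<Otimes>\<^sub>M borel)"
    and cs: "c\<^sup>2 + s\<^sup>2 = 1"
  shows "(\<integral>\<^sup>+x. \<integral>\<^sup>+y. h (c *\<^sub>R x + s *\<^sub>R y) (c *\<^sub>R y - s *\<^sub>R x) \<partial>gaussian \<partial>gaussian)
    = (\<integral>\<^sup>+x. \<integral>\<^sup>+y. h x y \<partial>gaussian \<partial>gaussian)"
proof -
  define R :: "'a \<times> 'a \<Rightarrow> 'a \<times> 'a"
    where "R = (\<lambda>p. (c *\<^sub>R fst p + s *\<^sub>R snd p, c *\<^sub>R snd p - s *\<^sub>R fst p))"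
  have "linear R"
    by (auto simp: R_def linear_iff algebra_simps)
  moreover have "R p \<bullet> R q = (c\<^sup>2 + s\<^sup>2) * (p \<bullet> q)" for p q
    by (auto simp: R_def inner_prod_def inner_simps power2_eq_square algebra_simps)
  ultimately have R: "orthogonal_transformation R"
    using cs by (simp add: orthogonal_transformation_def)
  have [measurable]: "case_prod h \<in> borel_measurable borel"
    by (simp add: borel_prod[symmetric])
  have "(\<integral>\<^sup>+x. \<integral>\<^sup>+y. h x y \<partial>gaussian \<partial>gaussian) = (\<integral>\<^sup>+p. case_prod h p \<partial>gaussian)"
    using gaussian.nn_integral_fst[of "case_prod h" gaussian]
    by (simp add: gaussian_pair_eq)
  also have "\<dots> = (\<integral>\<^sup>+p. case_prod h (R p) \<partial>gaussian)"
    by (simp add: nn_integral_gaussian_orthogonal[OF R])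
  also have "\<dots> = (\<integral>\<^sup>+x. \<integral>\<^sup>+y. case_prod h (R (x, y)) \<partial>gaussian \<partial>gaussian)"
    unfolding gaussian_pair_eq[symmetric]
    by (subst gaussian.nn_integral_fst[symmetric]) (simp_all add: R_def case_prod_beta')
  finally show ?thesis by (simp add: R_def)
qed

text \<open>
  Completing the square turns the integrand into a translate of the Gaussian density.
\<close>

lemma gaussian_mgf:
  fixes v :: "'a::euclidean_space"
  shows "(\<integral>\<^sup>+x. ennreal (exp (v \<bullet> x)) \<partial>gaussian) = ennreal (exp ((norm v)\<^sup>2 / 2))"
proof -
  have "gaussian_density x * exp (v \<bullet> x) = exp ((norm v)\<^sup>2 / 2) * gaussian_density (x + - v)" for x
    by (simp add: gaussian_density_def power2_norm_eq_inner inner_simps inner_commute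
        exp_add[symmetric] field_simps)
  then have "(\<integral>\<^sup>+x. ennreal (exp (v \<bullet> x)) \<partial>gaussian)
     = (\<integral>\<^sup>+x. ennreal (exp ((norm v)\<^sup>2 / 2)) * ennreal (gaussian_density (x + - v)) \<partial>lborel)"
    by (subst nn_integral_gaussian)
       (simp_all add: ennreal_mult[symmetric] gaussian_density_pos less_imp_le)
  also have "\<dots> = ennreal (exp ((norm v)\<^sup>2 / 2)) * (\<integral>\<^sup>+x. ennreal (gaussian_density (x :: 'a)) \<partial>lborel)"
    using nn_integral_lborel_translate[of "\<lambda>x. ennreal (gaussian_density x)" "- v"]
    by (subst nn_integral_cmult) (simp_all del: add_uminus_conv_diff)
  also have "(\<integral>\<^sup>+x. ennreal (gaussian_density (x :: 'a)) \<partial>lborel) = 1"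
    using gaussian.emeasure_space_1[where ?'a = 'a] nn_integral_gaussian[of "\<lambda>x::'a. 1"] by simp
  finally show ?thesis by simp
qed

lemma gaussian_integrable_norm: "integrable gaussian (norm :: 'a::euclidean_space \<Rightarrow> real)"
proof (rule Bochner_Integration.integrable_bound)
  have exp_int: "integrable gaussian (\<lambda>x. exp (v \<bullet> x))" for v :: 'a
    by (rule integrableI_bounded) (simp_all add: gaussian_mgf)
  show "integrable gaussian (\<lambda>x::'a. \<Sum>b\<in>Basis. exp (b \<bullet> x) + exp ((- b) \<bullet> x) :: real)"
    by (intro Bochner_Integration.integrable_sum Bochner_Integration.integrable_add exp_int)
  show "AE x::'a in gaussian. norm (norm x) \<le> norm (\<Sum>b\<in>Basis. exp (b \<bullet> x) + exp ((- b) \<bullet> x) :: real)"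
  proof (rule AE_I2)
    fix x :: 'a
    have "\<bar>t\<bar> \<le> exp t + exp (- t)" for t :: real
      using exp_ge_add_one_self[of t] exp_ge_add_one_self[of "- t"] exp_gt_zero[of t] exp_gt_zero[of "- t"] by linarith
    then have "norm x \<le> (\<Sum>b\<in>Basis. exp (b \<bullet> x) + exp ((- b) \<bullet> x))"
      by (intro order_trans[OF norm_le_l1] sum_mono) (simp add: inner_commute)
    then show "norm (norm x) \<le> norm (\<Sum>b\<in>Basis. exp (b \<bullet> x) + exp ((- b) \<bullet> x) :: real)"
      by simp
  qed
qed simp

lemma gaussian_open_pos:
  fixes U :: "'a::euclidean_space set"
  assumes "open U" "U \<noteq> {}"
  shows "0 < emeasure gaussian U"
proof -
  have [measurable]: "U \<in> sets borel" using assms(1) by simp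
  have "emeasure gaussian U \<noteq> 0"
  proof
    assume "emeasure gaussian U = 0"
    then have "AE x in lborel. x \<notin> U"
      unfolding gaussian_def
      by (subst (asm) emeasure_density)
         (auto simp: nn_integral_0_iff_AE gaussian_density_pos ennreal_eq_0_iff not_le indicator_def
             simp flip: not_less)
    then have "emeasure lborel U = 0"
      by (subst (asm) AE_iff_measurable) auto
    then show False
      using open_not_negligible[OF assms] by (simp add: negligible_iff_emeasure0)
  qed
  then show ?thesis by (simp add: zero_less_iff_neq_zero)
qed

section \<open>Projections and Gaussian measures on subspaces\<close>

lemma closest_point_subspace_eqI:
  fixes S :: "'a::euclidean_space set"
  assumes "subspace S" "y \<in> S" and orth: "\<And>z. z \<in> S \<Longrightarrow> (x - y) \<bullet> z = 0"
  shows "closest_point S x = y"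
proof -
  have "dist x y \<le> dist x z" if "z \<in> S" for z
  proof -
    have "(x - y) \<bullet> (y - z) = 0"
      using that assms by (intro orth) (simp add: subspace_diff)
    then have "(norm (x - z))\<^sup>2 = (norm (x - y))\<^sup>2 + (norm (y - z))\<^sup>2"
      using norm_add_Pythagorean[of "x - y" "y - z"] by (simp add: orthogonal_def)
    then have "(norm (x - y))\<^sup>2 \<le> (norm (x - z))\<^sup>2" by simp
    then show ?thesis by (simp add: dist_norm)
  qed
  then show ?thesis
    using closest_point_unique[OF subspace_imp_convex closed_subspace, of S y x] assms by auto
qed

lemma sum_orthonormal_inner:
  assumes "finite B" "pairwise orthogonal B" "\<And>b. b \<in> B \<Longrightarrow> norm b = 1" "c \<in> B"
  shows "(\<Sum>b\<in>B. g b *\<^sub>R b) \<bullet> c = g c"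
proof -
  have "(\<Sum>b\<in>B. g b *\<^sub>R b) \<bullet> c = (\<Sum>b\<in>B. if b = c then g c else 0)"
    unfolding inner_sum_left
    using assms by (intro sum.cong) (auto simp: pairwise_def orthogonal_def norm_eq_1)
  then show ?thesis using assms by simp
qed

lemma closest_point_span_orthonormal:
  fixes B :: "'a::euclidean_space set"
  assumes "finite B" "pairwise orthogonal B" "\<And>b. b \<in> B \<Longrightarrow> norm b = 1"
  shows "closest_point (span B) x = (\<Sum>b\<in>B. (x \<bullet> b) *\<^sub>R b)"
proof (rule closest_point_subspace_eqI[OF subspace_span])
  show "(x - (\<Sum>b\<in>B. (x \<bullet> b) *\<^sub>R b)) \<bullet> z = 0" if "z \<in> span B" for z
    using that
  proof (induction rule: span_induct)
    case base
    show ?case by (simp add: subspace_hyperplane)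
  next
    case (step b)
    then show ?case
      using sum_orthonormal_inner[OF assms, of b] by (simp add: inner_diff_left)
  qed
qed (auto intro: span_sum span_scale span_base)

lemma orthonormal_basis_ex:
  assumes "subspace (F :: 'a::euclidean_space set)"
  obtains B where "orthonormal_basis_of F B"
  using orthonormal_basis_subspace[OF assms] unfolding orthonormal_basis_of_def by metis

lemma orthonormal_basis_of_finite:
  assumes "orthonormal_basis_of F (B :: 'a::euclidean_space set)"
  shows "finite B" "card B = dim F"
proof -
  have "independent B"
    using assms unfolding orthonormal_basis_of_def
    by (intro pairwise_orthogonal_independent) auto
  then show "finite B" "card B = dim F"
    using assms independent_imp_finite
    by (auto simp: orthonormal_basis_of_def indep_card_eq_dim_span)
qed

lemma linear_closest_point:
  assumes "subspace (F :: 'a::euclidean_space set)"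
  shows "linear (closest_point F)"
proof -
  obtain B where B: "orthonormal_basis_of F B"
    using orthonormal_basis_ex[OF assms] .
  then have "closest_point F = (\<lambda>x. \<Sum>b\<in>B. (x \<bullet> b) *\<^sub>R b)"
    using orthonormal_basis_of_finite[OF B] closest_point_span_orthonormal[of B]
    by (auto simp: orthonormal_basis_of_def)
  then show ?thesis
    by (simp add: linear_iff inner_simps sum.distrib scaleR_sum_right algebra_simps)
qed

text \<open>
  Adding an orthonormal basis of the orthogonal complement of the span.
\<close>

lemma orthonormal_extension_full:
  fixes B :: "'a::euclidean_space set"
  assumes "pairwise orthogonal B" "\<And>b. b \<in> B \<Longrightarrow> norm b = 1"
  obtains B' where "B \<subseteq> B'" "finite B'" "pairwise orthogonal B'" "\<And>b. b \<in> B' \<Longrightarrow> norm b = 1"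
    "card B' = DIM('a)"
proof -
  define W where "W = {y. \<forall>x\<in>span B. orthogonal x y}"
  have "subspace W"
    unfolding W_def orthogonal_def by (auto intro!: subspaceI simp: inner_simps)
  then obtain C where C: "C \<subseteq> W" "pairwise orthogonal C" "\<And>x. x \<in> C \<Longrightarrow> norm x = 1"
    "independent C" "card C = dim W"
    using orthonormal_basis_subspace by metis
  have "0 \<notin> B" using assms(2) by fastforce
  then have "independent B"
    using assms(1) by (intro pairwise_orthogonal_independent)
  then have B: "finite B" "card B = dim (span B)"
    using independent_imp_finite by (auto simp: indep_card_eq_dim_span)
  have cross: "orthogonal x y" if "x \<in> B" "y \<in> C" for x y
    using that C(1) span_base by (auto simp: W_def)
  then have "B \<inter> C = {}"
    using assms(2) by (fastforce simp: orthogonal_def norm_eq_1)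
  moreover have "dim W + dim (span B) = DIM('a)"
    using dim_subspace_orthogonal_to_vectors[of "span B" UNIV] by (simp add: W_def)
  ultimately have "card (B \<union> C) = DIM('a)"
    using B C(4,5) independent_imp_finite by (subst card_Un_disjoint) auto
  moreover have "pairwise orthogonal (B \<union> C)"
    using assms(1) C(2) cross orthogonal_commute
    by (auto simp: pairwise_def) blast
  ultimately show thesis
    using that[of "B \<union> C"] assms(2) B(1) C(3,4) independent_imp_finite by auto
qed

text \<open>
  The coordinates of a Gaussian vector along any orthonormal system are independent standard normal
  variables: an orthogonal transformation carries the standard basis to an extension of the system,
  and the density factorises over the standard basis.
\<close>

lemma nn_integral_gaussian_orthonormal:
  fixes f :: "'a::euclidean_space \<Rightarrow> real \<Rightarrow> ennreal"
  assumes B: "pairwise orthogonal B" "\<And>b. b \<in> B \<Longrightarrow> norm b = 1"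
    and f [measurable]: "\<And>b. f b \<in> borel_measurable borel"
  shows "(\<integral>\<^sup>+x. (\<Prod>b\<in>B. f b (x \<bullet> b)) \<partial>gaussian)
    = (\<Prod>b\<in>B. \<integral>\<^sup>+t. f b t \<partial>density lborel std_normal_density)"
proof -
  obtain B' where B': "B \<subseteq> B'" "finite B'" "pairwise orthogonal B'" "\<And>b. b \<in> B' \<Longrightarrow> norm b = 1"
    "card B' = DIM('a)"
    using orthonormal_extension_full[OF B] by metis
  obtain h where h: "bij_betw h (Basis :: 'a set) B'"
    using B'(2,5) by (metis finite_Basis finite_same_card_bij)
  define T where "T x = (\<Sum>e\<in>Basis. (x \<bullet> e) *\<^sub>R h e)" for x
  have hh: "h e \<bullet> h e' = (if e' = e then 1 else 0)" if "e \<in> Basis" "e' \<in> Basis" for e e'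
    using that B'(3,4) bij_betwE[OF h] bij_betw_imp_inj_on[OF h]
    by (auto simp: pairwise_def orthogonal_def norm_eq_1 inj_on_eq_iff)
  have T_h: "T x \<bullet> h e = x \<bullet> e" if "e \<in> Basis" for x e
    using that by (simp add: T_def inner_sum_left hh if_distrib sum.delta cong: if_cong)
  have "linear T"
    by (simp add: T_def linear_iff inner_simps sum.distrib scaleR_sum_right algebra_simps)
  moreover have "T x \<bullet> T y = x \<bullet> y" for x y
    by (subst (2) T_def) (simp add: inner_sum_right T_h euclidean_inner[of x y] mult.commute)
  ultimately have T: "orthogonal_transformation T"
    by (simp add: orthogonal_transformation_def)
  define g where "g b = (if b \<in> B then f b else (\<lambda>_. 1))" for b
  have [measurable]: "g b \<in> borel_measurable borel" for b
    by (simp add: g_def)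
  have "(\<integral>\<^sup>+x. (\<Prod>b\<in>B. f b (x \<bullet> b)) \<partial>gaussian) = (\<integral>\<^sup>+x. (\<Prod>b\<in>B'. g b (x \<bullet> b)) \<partial>gaussian)"
    using B'(1,2) by (intro nn_integral_cong prod.mono_neutral_cong_left) (auto simp: g_def)
  also have "\<dots> = (\<integral>\<^sup>+x. (\<Prod>b\<in>B'. g b (T x \<bullet> b)) \<partial>gaussian)"
    by (rule nn_integral_gaussian_orthogonal[OF T, symmetric]) measurable
  also have "\<dots> = (\<integral>\<^sup>+x. (\<Prod>e\<in>Basis. g (h e) (x \<bullet> e)) \<partial>gaussian)"
    by (simp add: prod.reindex_bij_betw[OF h, symmetric] T_h)
  also have "\<dots> = (\<Prod>e\<in>Basis. \<integral>\<^sup>+t. g (h e) t \<partial>density lborel std_normal_density)"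
    by (rule nn_integral_gaussian_Basis) measurable
  also have "\<dots> = (\<Prod>b\<in>B'. \<integral>\<^sup>+t. g b t \<partial>density lborel std_normal_density)"
    by (rule prod.reindex_bij_betw[OF h])
  also have "\<dots> = (\<Prod>b\<in>B. \<integral>\<^sup>+t. f b t \<partial>density lborel std_normal_density)"
    using B'(1,2) prob_space.emeasure_space_1[OF prob_space_std_normal]
    by (intro prod.mono_neutral_cong_right) (auto simp: g_def)
  finally show ?thesis .
qed

text \<open>
  This replaces the chosen orthonormal basis of F by the canonical projection of a Gaussian vector of
  the whole space, whose law has all the symmetries of F.
\<close>

lemma std_gaussian_eq_distr:
  fixes F :: "'a::euclidean_space set"
  assumes "subspace F"
  shows "std_gaussian F = distr gaussian borel (closest_point F)"
proof -
  define B where "B = (SOME B. orthonormal_basis_of F B)"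
  have B: "orthonormal_basis_of F B"
    unfolding B_def using orthonormal_basis_ex[OF assms] by (metis someI_ex)
  then have on: "pairwise orthogonal B" "\<And>b. b \<in> B \<Longrightarrow> norm b = 1" "span B = F"
    by (auto simp: orthonormal_basis_of_def)
  note fin = orthonormal_basis_of_finite(1)[OF B]
  let ?N = "density lborel (\<lambda>x. ennreal (std_normal_density x))"
  let ?co = "\<lambda>x. \<lambda>b\<in>B. x \<bullet> b"
  interpret N: prob_space ?N by (rule prob_space_std_normal)
  interpret product_prob_space "\<lambda>_. ?N" B ..
  have co [measurable]: "?co \<in> gaussian \<rightarrow>\<^sub>M Pi\<^sub>M B (\<lambda>_. ?N)"
    by (rule measurable_restrict) simp
  have "distr gaussian (Pi\<^sub>M B (\<lambda>_. ?N)) ?co = Pi\<^sub>M B (\<lambda>_. ?N)"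
  proof (rule PiM_eqI[OF fin])
    fix A assume A: "\<And>b. b \<in> B \<Longrightarrow> A b \<in> sets ?N"
    define A' where "A' b = (if b \<in> B then A b else {})" for b
    have [measurable]: "A' b \<in> sets borel" for b
      using A by (simp add: A'_def)
    have "emeasure (distr gaussian (Pi\<^sub>M B (\<lambda>_. ?N)) ?co) (Pi\<^sub>E B A)
      = emeasure gaussian (?co -` Pi\<^sub>E B A)"
      using A fin by (subst emeasure_distr[OF co]) (auto intro!: sets_PiM_I_finite)
    also have "\<dots> = (\<integral>\<^sup>+x. indicator (?co -` Pi\<^sub>E B A) x \<partial>gaussian)"
      using measurable_sets[OF co sets_PiM_I_finite[OF fin A]] by simp
    also have "\<dots> = (\<integral>\<^sup>+x. (\<Prod>b\<in>B. indicator (A' b) (x \<bullet> b)) \<partial>gaussian)"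
      using fin by (intro nn_integral_cong)
        (auto simp: indicator_def A'_def PiE_iff prod_zero_iff split: if_splits intro!: prod.neutral[symmetric] prod_zero[symmetric])
    also have "\<dots> = (\<Prod>b\<in>B. emeasure ?N (A' b))"
      by (subst nn_integral_gaussian_orthonormal[OF on(1,2), where f = "\<lambda>b. indicator (A' b)"]) simp_all
    also have "\<dots> = (\<Prod>b\<in>B. emeasure ?N (A b))"
      by (simp add: A'_def)
    finally show "emeasure (distr gaussian (Pi\<^sub>M B (\<lambda>_. ?N)) ?co) (Pi\<^sub>E B A)
      = (\<Prod>b\<in>B. emeasure ?N (A b))" .
  qed simp
  then have "std_gaussian F = distr (distr gaussian (Pi\<^sub>M B (\<lambda>_. ?N)) ?co) borel (\<lambda>g. \<Sum>b\<in>B. g b *\<^sub>R b)"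
    unfolding std_gaussian_def Let_def B_def[symmetric] by simp
  also have "\<dots> = distr gaussian borel (\<lambda>x. \<Sum>b\<in>B. (x \<bullet> b) *\<^sub>R b)"
    by (subst distr_distr) (auto simp: comp_def cong: sum.cong)
  also have "(\<lambda>x. \<Sum>b\<in>B. (x \<bullet> b) *\<^sub>R b) = closest_point F"
    using closest_point_span_orthonormal[OF fin on(1,2)] on(3) by auto
  finally show ?thesis .
qed

lemma gaussian_square_mgf_1:
  "(\<integral>\<^sup>+t. ennreal (exp (- t\<^sup>2 / 2)) \<partial>density lborel std_normal_density) = ennreal (1 / sqrt 2)"
proof -
  have "std_normal_density t * exp (- t\<^sup>2 / 2) = 1 / sqrt 2 * normal_density 0 (1 / sqrt 2) t" for t
    by (simp add: normal_density_def exp_add[symmetric] real_sqrt_mult power_divide field_simps)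
  then have "(\<integral>\<^sup>+t. ennreal (exp (- t\<^sup>2 / 2)) \<partial>density lborel std_normal_density)
    = (\<integral>\<^sup>+t. ennreal (1 / sqrt 2) * ennreal (normal_density 0 (1 / sqrt 2) t) \<partial>lborel)"
    by (subst nn_integral_density) (simp_all add: ennreal_mult[symmetric])
  also have "\<dots> = ennreal (1 / sqrt 2) * 1"
    using prob_space.emeasure_space_1[OF prob_space_normal_density[of "1 / sqrt 2" 0]]
    by (subst nn_integral_cmult) (simp_all add: emeasure_density)
  finally show ?thesis by simp
qed

text \<open>
  The squared norm of the projection is a sum of dim F independent squared standard normal variables.
\<close>

lemma gaussian_small_ball_mgf:
  fixes F :: "'a::euclidean_space set"
  assumes "subspace F"
  shows "(\<integral>\<^sup>+x. ennreal (exp (- (norm (closest_point F x))\<^sup>2 / 2)) \<partial>gaussian)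
    = ennreal ((1 / sqrt 2) ^ dim F)"
proof -
  obtain B where B: "orthonormal_basis_of F B"
    using orthonormal_basis_ex[OF assms] .
  then have on: "pairwise orthogonal B" "\<And>b. b \<in> B \<Longrightarrow> norm b = 1" "span B = F"
    by (auto simp: orthonormal_basis_of_def)
  note fin = orthonormal_basis_of_finite[OF B]
  have P: "closest_point F x = (\<Sum>b\<in>B. (x \<bullet> b) *\<^sub>R b)" for x
    using closest_point_span_orthonormal[OF fin(1) on(1,2)] on(3) by auto
  have "(norm (closest_point F x))\<^sup>2 = (\<Sum>b\<in>B. (x \<bullet> b)\<^sup>2)" for x
    unfolding power2_norm_eq_inner P
    by (subst inner_sum_right) (simp add: sum_orthonormal_inner[OF fin(1) on(1,2)] power2_eq_square)
  then have "exp (- (norm (closest_point F x))\<^sup>2 / 2) = (\<Prod>b\<in>B. exp (- (x \<bullet> b)\<^sup>2 / 2))" for x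
    using fin(1) by (simp add: exp_sum[symmetric] sum_negf sum_divide_distrib)
  then have "(\<integral>\<^sup>+x. ennreal (exp (- (norm (closest_point F x))\<^sup>2 / 2)) \<partial>gaussian)
    = (\<integral>\<^sup>+x. (\<Prod>b\<in>B. ennreal (exp (- (x \<bullet> b)\<^sup>2 / 2))) \<partial>gaussian)"
    by (simp add: prod_ennreal)
  also have "\<dots> = (\<Prod>b\<in>B. ennreal (1 / sqrt 2))"
    by (subst nn_integral_gaussian_orthonormal[OF on(1,2), where f = "\<lambda>_ t. ennreal (exp (- t\<^sup>2 / 2))"])
       (simp_all only: gaussian_square_mgf_1, measurable)
  also have "\<dots> = ennreal ((1 / sqrt 2) ^ dim F)"
    by (simp add: fin(2) ennreal_power)
  finally show ?thesis .
qed

section \<open>Gaussian concentration for maxima of linear functionals\<close>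

text \<open>
  For the maximum \<phi> of finitely many linear functionals u (and of 0), this picks at each point a
  functional that attains the maximum, so that \<open>\<phi> x = active us x \<bullet> x\<close> and \<open>active us x\<close> is a
  subgradient of \<phi> at x. Recursion over a list makes the choice measurable.
\<close>

primrec active :: "'a list \<Rightarrow> 'a::euclidean_space \<Rightarrow> 'a" where
  "active [] x = 0"
| "active (u # us) x = (if active us x \<bullet> x \<le> u \<bullet> x then u else active us x)"

lemma active_mem: "active us x \<in> insert 0 (set us)"
  by (induction us) auto

lemma active_ge: "u \<in> insert 0 (set us) \<Longrightarrow> u \<bullet> x \<le> active us x \<bullet> x"
  by (induction us) (auto intro: order_trans)

lemma active_inner_le: "active us x \<bullet> y \<le> active us y \<bullet> y"
  by (rule active_ge[OF active_mem])

lemma active_nonneg: "0 \<le> active us x \<bullet> x"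
  using active_ge[of 0 us x] by simp

lemma active_measurable [measurable]: "active us \<in> borel_measurable borel"
  by (induction us) (simp_all, measurable)

lemma active_norm_le:
  assumes "\<And>u. u \<in> set us \<Longrightarrow> norm u \<le> b" "0 \<le> b"
  shows "norm (active us x) \<le> b"
  using active_mem[of us x] assms by auto

text \<open>
  A discrete form of the Maurey-Pisier interpolation. The points X i move from x to y on a
  quarter of an ellipse, and Y i is the velocity at X i. Since
  \<open>X i = cos h *\<^sub>R X (Suc i) - sin h *\<^sub>R Y (Suc i)\<close>, testing \<phi> (X i) with the functional that is active
  at X (Suc i) bounds the increment \<open>cos h * \<phi> (X (Suc i)) - \<phi> (X i)\<close> by a linear functional of the
  velocity. The positive homogeneity of \<phi> makes this exact, with no second-order error; the price is
  the factor \<open>cos h ^ m\<close>, which tends to 1 with the number m of steps.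
\<close>

lemma active_path_ineq:
  fixes x y :: "'a::euclidean_space" and m :: nat
  assumes m: "0 < m"
  defines "h \<equiv> pi / (2 * real m)"
  defines "X \<equiv> \<lambda>i. cos (real i * h) *\<^sub>R x + sin (real i * h) *\<^sub>R y"
    and "Y \<equiv> \<lambda>i. cos (real i * h) *\<^sub>R y - sin (real i * h) *\<^sub>R x"
  shows "cos h ^ m * (active us y \<bullet> y) - active us x \<bullet> x
    \<le> (\<Sum>i<m. cos h ^ i * sin h * (active us (X (Suc i)) \<bullet> Y (Suc i)))"
proof -
  define \<phi> where "\<phi> z = active us z \<bullet> z" for z
  have h: "0 < h" "h \<le> pi / 2"
    using m by (auto simp: h_def field_simps)
  have X_eq: "X i = cos h *\<^sub>R X (Suc i) - sin h *\<^sub>R Y (Suc i)" for i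
  proof -
    have "real i * h = real (Suc i) * h - h" by (simp add: algebra_simps)
    then have "X i = cos (real (Suc i) * h - h) *\<^sub>R x + sin (real (Suc i) * h - h) *\<^sub>R y"
      by (simp only: X_def)
    also have "\<dots> = cos h *\<^sub>R X (Suc i) - sin h *\<^sub>R Y (Suc i)"
      by (simp only: X_def Y_def cos_diff sin_diff) (simp only: algebra_simps scaleR_scaleR)
    finally show ?thesis .
  qed
  have step: "cos h * \<phi> (X (Suc i)) - \<phi> (X i) \<le> sin h * (active us (X (Suc i)) \<bullet> Y (Suc i))" for i
  proof -
    have "active us (X (Suc i)) \<bullet> X i
      = cos h * \<phi> (X (Suc i)) - sin h * (active us (X (Suc i)) \<bullet> Y (Suc i))"
      by (subst X_eq) (simp add: \<phi>_def inner_diff_right)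
    then show ?thesis
      using active_inner_le[of us "X (Suc i)" "X i"] by (simp add: \<phi>_def)
  qed
  have "cos (real m * h) = 0" "sin (real m * h) = 1"
    using m by (simp_all add: h_def)
  then have "X m = y" "X 0 = x"
    by (simp_all add: X_def)
  then have "cos h ^ m * \<phi> y - \<phi> x = (\<Sum>i<m. cos h ^ Suc i * \<phi> (X (Suc i)) - cos h ^ i * \<phi> (X i))"
    by (subst sum_lessThan_telescope) simp
  also have "\<dots> = (\<Sum>i<m. cos h ^ i * (cos h * \<phi> (X (Suc i)) - \<phi> (X i)))"
    by (simp add: algebra_simps)
  also have "\<dots> \<le> (\<Sum>i<m. cos h ^ i * (sin h * (active us (X (Suc i)) \<bullet> Y (Suc i))))"
    using h by (intro sum_mono mult_left_mono step zero_le_power cos_ge_zero) auto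
  finally show ?thesis by (simp add: \<phi>_def mult.assoc)
qed

lemma nn_integral_active_mgf_le:
  fixes us :: "'a::euclidean_space list"
  assumes us: "\<And>u. u \<in> set us \<Longrightarrow> norm u \<le> b" and b: "0 \<le> b" and a: "0 \<le> a" "a \<le> A"
  shows "(\<integral>\<^sup>+x. \<integral>\<^sup>+y. ennreal (exp (a * (active us x \<bullet> y))) \<partial>gaussian \<partial>gaussian)
    \<le> ennreal (exp (A\<^sup>2 * b\<^sup>2 / 2))"
proof -
  have "(\<integral>\<^sup>+y. ennreal (exp (a * (active us x \<bullet> y))) \<partial>gaussian) \<le> ennreal (exp (A\<^sup>2 * b\<^sup>2 / 2))" for x
  proof -
    have "(\<integral>\<^sup>+y. ennreal (exp (a * (active us x \<bullet> y))) \<partial>gaussian)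
      = ennreal (exp ((a * norm (active us x))\<^sup>2 / 2))"
      using gaussian_mgf[of "a *\<^sub>R active us x"] a by simp
    also have "(a * norm (active us x))\<^sup>2 \<le> (A * b)\<^sup>2"
      using a active_norm_le[OF us b] by (intro power_mono mult_mono) auto
    finally show ?thesis
      by (simp add: power_mult_distrib ennreal_leI)
  qed
  then have "(\<integral>\<^sup>+x. \<integral>\<^sup>+y. ennreal (exp (a * (active us x \<bullet> y))) \<partial>gaussian \<partial>gaussian)
    \<le> (\<integral>\<^sup>+x. ennreal (exp (A\<^sup>2 * b\<^sup>2 / 2)) \<partial>(gaussian :: 'a measure))"
    by (intro nn_integral_mono)
  then show ?thesis
    using gaussian.emeasure_space_1[where ?'a = 'a] by simp
qed

text \<open>
  The left-hand side is the exponential moment of \<open>l * (cos h ^ m * \<phi> Y - \<phi> X)\<close> for independent X and Y.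
  By convexity of exp, the sum over the path is replaced by a weighted average of exponentials. Each
  of them has the same expectation as at the starting point of the path, by rotation invariance, and
  there the velocity is a Gaussian vector independent of the active functional. The weights add up to
  at most \<open>m * h = pi / 2\<close>.
\<close>

lemma active_decoupled_mgf:
  fixes us :: "'a::euclidean_space list"
  assumes us: "\<And>u. u \<in> set us \<Longrightarrow> norm u \<le> b" and b: "0 \<le> b" and l: "0 \<le> l" and m: "0 < m"
  shows "(\<integral>\<^sup>+y. ennreal (exp (l * (cos (pi / (2 * real m)) ^ m * (active us y \<bullet> y)))) \<partial>gaussian)
      * (\<integral>\<^sup>+x. ennreal (exp (- (l * (active us x \<bullet> x)))) \<partial>gaussian)
    \<le> ennreal (exp (l\<^sup>2 * pi\<^sup>2 * b\<^sup>2 / 8))"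
proof -
  define h where "h = pi / (2 * real m)"
  define c where "c = cos h"
  have h: "0 < h" "h \<le> pi / 2"
    using m by (auto simp: h_def field_simps)
  have c: "0 \<le> c" "c \<le> 1" and sh: "0 < sin h" "sin h \<le> h"
    using h pi_gt_zero by (auto simp: c_def cos_ge_zero sin_gt_zero sin_x_le_x)
  \<comment> \<open>W is the total weight; normalising by it gives a convex combination.\<close>
  define w where "w i = c ^ i * sin h" for i
  define W where "W = (\<Sum>i<m. w i)"
  have w: "0 \<le> w i" "w i \<le> h" for i
    using c sh mult_mono[of "c ^ i" 1 "sin h" h] by (auto simp: w_def power_le_one)
  have "w 0 \<le> W"
    unfolding W_def using m w(1) by (intro member_le_sum) auto
  then have "0 < W" using sh by (simp add: w_def)
  have "W \<le> (\<Sum>i<m. h)"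
    unfolding W_def by (intro sum_mono w(2))
  then have "W \<le> pi / 2"
    using m by (simp add: h_def)
  define D where "D i x y = active us (cos (real (Suc i) * h) *\<^sub>R x + sin (real (Suc i) * h) *\<^sub>R y)
      \<bullet> (cos (real (Suc i) * h) *\<^sub>R y - sin (real (Suc i) * h) *\<^sub>R x)" for i x y
  have [measurable]: "(\<lambda>(x, y). D i x y) \<in> borel_measurable (borel \<Otimes>\<^sub>M borel)" for i
    unfolding D_def by measurable
  have exp_le: "exp (l * (c ^ m * (active us y \<bullet> y))) * exp (- (l * (active us x \<bullet> x)))
    \<le> (\<Sum>i<m. w i / W * exp (l * W * D i x y))" for x y
  proof -
    have "exp (l * (c ^ m * (active us y \<bullet> y))) * exp (- (l * (active us x \<bullet> x)))
      = exp (l * (c ^ m * (active us y \<bullet> y) - active us x \<bullet> x))"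
      by (simp add: exp_add[symmetric] algebra_simps)
    also have "\<dots> \<le> exp (l * (\<Sum>i<m. w i * D i x y))"
      using active_path_ineq[OF m, of us y x] l
      by (simp add: h_def c_def w_def D_def mult_left_mono)
    also have "l * (\<Sum>i<m. w i * D i x y) = (\<Sum>i<m. (w i / W) *\<^sub>R (l * W * D i x y))"
      using \<open>0 < W\<close> by (simp add: sum_distrib_left mult_ac)
    also have "exp \<dots> \<le> (\<Sum>i<m. w i / W * exp (l * W * D i x y))"
      using m w(1) \<open>0 < W\<close>
      by (intro convex_on_sum[OF _ _ exp_convex]) (auto simp: W_def sum_divide_distrib[symmetric])
    finally show ?thesis .
  qed
  have term_le: "(\<integral>\<^sup>+x. \<integral>\<^sup>+y. ennreal (exp (l * W * D i x y)) \<partial>gaussian \<partial>gaussian)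
    \<le> ennreal (exp ((l * (pi / 2))\<^sup>2 * b\<^sup>2 / 2))" for i
  proof -
    have meas: "(\<lambda>(x, y). ennreal (exp (l * W * (active us x \<bullet> y)))) \<in> borel_measurable (borel \<Otimes>\<^sub>M borel)"
      by measurable
    have "(\<integral>\<^sup>+x. \<integral>\<^sup>+y. ennreal (exp (l * W * D i x y)) \<partial>gaussian \<partial>gaussian)
      = (\<integral>\<^sup>+x. \<integral>\<^sup>+y. ennreal (exp (l * W * (active us x \<bullet> y))) \<partial>gaussian \<partial>gaussian)"
      unfolding D_def
      by (rule nn_integral_gaussian_rotation[OF meas sin_cos_squared_add2])
    also have "\<dots> \<le> ennreal (exp ((l * (pi / 2))\<^sup>2 * b\<^sup>2 / 2))"
      using l \<open>0 < W\<close> \<open>W \<le> pi / 2\<close> by (intro nn_integral_active_mgf_le us b mult_left_mono) auto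
    finally show ?thesis .
  qed
  have "(\<integral>\<^sup>+y. ennreal (exp (l * (c ^ m * (active us y \<bullet> y)))) \<partial>gaussian)
      * (\<integral>\<^sup>+x. ennreal (exp (- (l * (active us x \<bullet> x)))) \<partial>gaussian)
    = (\<integral>\<^sup>+x. \<integral>\<^sup>+y. ennreal (exp (l * (c ^ m * (active us y \<bullet> y))) * exp (- (l * (active us x \<bullet> x)))) \<partial>gaussian \<partial>gaussian)"
    by (simp add: ennreal_mult nn_integral_multc nn_integral_cmult)
  also have "\<dots> \<le> (\<integral>\<^sup>+x. \<integral>\<^sup>+y. (\<Sum>i<m. ennreal (w i / W) * ennreal (exp (l * W * D i x y))) \<partial>gaussian \<partial>gaussian)"
    using exp_le w(1) \<open>0 < W\<close>
    by (intro nn_integral_mono) (simp add: ennreal_mult[symmetric] ennreal_leI)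
  also have "\<dots> = (\<Sum>i<m. ennreal (w i / W) * (\<integral>\<^sup>+x. \<integral>\<^sup>+y. ennreal (exp (l * W * D i x y)) \<partial>gaussian \<partial>gaussian))"
    by (simp add: nn_integral_sum nn_integral_cmult)
  also have "\<dots> \<le> (\<Sum>i<m. ennreal (w i / W) * ennreal (exp ((l * (pi / 2))\<^sup>2 * b\<^sup>2 / 2)))"
    by (intro sum_mono mult_left_mono term_le) simp
  also have "\<dots> = ennreal (\<Sum>i<m. w i / W) * ennreal (exp ((l * (pi / 2))\<^sup>2 * b\<^sup>2 / 2))"
    using w(1) \<open>0 < W\<close> by (simp add: sum_distrib_right[symmetric])
  also have "\<dots> = ennreal (exp (l\<^sup>2 * pi\<^sup>2 * b\<^sup>2 / 8))"
    using \<open>0 < W\<close> by (simp add: sum_divide_distrib[symmetric] W_def[symmetric] power_mult_distrib power_divide)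
  finally show ?thesis
    by (simp add: c_def h_def)
qed


lemma norm_bounded_integrable:
  fixes f :: "'a::euclidean_space \<Rightarrow> real"
  assumes [measurable]: "f \<in> borel_measurable borel" and "\<And>x. \<bar>f x\<bar> \<le> b * norm x"
  shows "integrable gaussian f"
proof (rule Bochner_Integration.integrable_bound)
  show "integrable gaussian (\<lambda>x::'a. b * norm x)"
    using gaussian_integrable_norm[where ?'a = 'a] by simp
  show "AE x in gaussian. norm (f x) \<le> norm (b * norm x)"
    unfolding real_norm_def by (intro AE_I2 order_trans[OF assms(2) abs_ge_self])
qed simp

text \<open>
  Bernoulli's inequality for \<open>cos h \<ge> 1 - h\<^sup>2 / 2\<close>: the loss over the whole path is of order 1 / m.
\<close>

lemma cos_power_ge:
  assumes "0 < m"
  shows "1 - pi\<^sup>2 / (8 * real m) \<le> cos (pi / (2 * real m)) ^ m"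
proof -
  define h where "h = pi / (2 * real m)"
  have h: "0 < h" "h \<le> pi / 2"
    using assms by (auto simp: h_def field_simps)
  have "cos h = 1 - 2 * (sin (h / 2))\<^sup>2"
    using cos_double_sin[of "h / 2"] by simp
  moreover have "(sin (h / 2))\<^sup>2 \<le> (h / 2)\<^sup>2"
    using h pi_gt_zero by (intro power_mono sin_x_le_x sin_ge_zero) auto
  ultimately have "1 - h\<^sup>2 / 2 \<le> cos h"
    by (simp add: power_divide)
  then have "real m * (- (h\<^sup>2 / 2)) \<le> real m * (cos h - 1)"
    by (intro mult_left_mono) auto
  then have "1 - real m * h\<^sup>2 / 2 \<le> 1 + real m * (cos h - 1)"
    by simp
  also have "\<dots> \<le> (1 + (cos h - 1)) ^ m"
    using h by (intro Bernoulli_inequality) (simp add: cos_ge_zero)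
  also have "real m * h\<^sup>2 / 2 = pi\<^sup>2 / (8 * real m)"
    using assms by (simp add: h_def power2_eq_square field_simps)
  finally show ?thesis by (simp add: h_def)
qed

lemma le_exp_limit:
  fixes p x y z l t a :: real
  assumes "\<And>m::nat. 0 < m \<Longrightarrow> p \<le> exp (x - l * ((1 - a / (8 * real m)) * t) + z)"
  shows "p \<le> exp (x - l * t + z)"
proof -
  have "(\<lambda>m. exp (x - l * ((1 - a / 8 * inverse (real m)) * t) + z))
    \<longlonglongrightarrow> exp (x - l * ((1 - a / 8 * 0) * t) + z)"
    by (rule tendsto_exp) (intro tendsto_const tendsto_add tendsto_diff tendsto_mult lim_inverse_n)
  moreover have "\<exists>M. \<forall>m\<ge>M. p \<le> exp (x - l * ((1 - a / 8 * inverse (real m)) * t) + z)"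
  proof (intro exI[of _ 1] allI impI)
    fix m :: nat assume "1 \<le> m"
    then have "0 < m" by simp
    have eq: "a / (8 * real m) = a / 8 * inverse (real m)"
      by (simp only: divide_inverse inverse_mult_distrib mult.assoc)
    show "p \<le> exp (x - l * ((1 - a / 8 * inverse (real m)) * t) + z)"
      using assms[OF \<open>0 < m\<close>] unfolding eq .
  qed
  ultimately have "p \<le> exp (x - l * ((1 - a / 8 * 0) * t) + z)"
    by (rule LIMSEQ_le_const)
  then show ?thesis by simp
qed

text \<open>
  Jensen's inequality removes one of the two independent copies in \<open>active_decoupled_mgf\<close> in favour of
  the mean e, Markov's inequality turns the exponential moment into a tail bound, and then m tends to
  infinity.
\<close>

lemma active_tail:
  fixes us :: "'a::euclidean_space list"
  assumes us: "\<And>u. u \<in> set us \<Longrightarrow> norm u \<le> b" and b: "0 \<le> b" and l: "0 \<le> l" and t: "0 \<le> t"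
  defines "e \<equiv> (\<integral>x. active us x \<bullet> x \<partial>gaussian)"
  shows "measure gaussian {x. t \<le> active us x \<bullet> x} \<le> exp (l * e - l * t + l\<^sup>2 * pi\<^sup>2 * b\<^sup>2 / 8)"
proof -
  define \<phi> where "\<phi> z = active us z \<bullet> z" for z
  define p where "p = measure gaussian {x. t \<le> \<phi> x}"
  have [measurable]: "\<phi> \<in> borel_measurable borel"
    unfolding \<phi>_def by measurable
  have "\<bar>\<phi> x\<bar> \<le> b * norm x" for x
    unfolding \<phi>_def
    by (rule order_trans[OF Cauchy_Schwarz_ineq2 mult_right_mono[OF active_norm_le[OF us b] norm_ge_zero]])
  then have int_phi: "integrable gaussian \<phi>"
    by (intro norm_bounded_integrable) auto
  have int_exp: "integrable gaussian (\<lambda>x. exp (- (l * \<phi> x)))"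
    using l by (intro gaussian.integrable_const_bound[of _ 1]) (auto simp: \<phi>_def active_nonneg)
  \<comment> \<open>Jensen for exp: integrate its tangent at the mean.\<close>
  have "exp (- (l * e)) = (\<integral>x. exp (- (l * e)) * (1 + l * e - l * \<phi> x) \<partial>gaussian)"
  proof -
    have "(\<integral>x. exp (- (l * e)) * (1 + l * e - l * \<phi> x) \<partial>gaussian)
      = exp (- (l * e)) * (1 + l * e - l * (\<integral>x. \<phi> x \<partial>gaussian))"
      using int_phi gaussian.prob_space[where ?'a = 'a] by simp
    also have "(\<integral>x. \<phi> x \<partial>gaussian) = e"
      by (simp add: e_def \<phi>_def)
    finally show ?thesis by simp
  qed
  also have "\<dots> \<le> (\<integral>x. exp (- (l * \<phi> x)) \<partial>gaussian)"
  proof (rule integral_mono)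
    show "exp (- (l * e)) * (1 + l * e - l * \<phi> x) \<le> exp (- (l * \<phi> x))" for x
    proof -
      have "exp (- (l * e)) * (1 + (l * e - l * \<phi> x)) \<le> exp (- (l * e)) * exp (l * e - l * \<phi> x)"
        by (intro mult_left_mono exp_ge_add_one_self) simp
      then show ?thesis by (simp add: exp_add[symmetric] algebra_simps)
    qed
  qed (use int_phi int_exp in simp_all)
  finally have jensen: "ennreal (exp (- (l * e))) \<le> (\<integral>\<^sup>+x. ennreal (exp (- (l * \<phi> x))) \<partial>gaussian)"
    using int_exp by (simp add: nn_integral_eq_integral ennreal_leI)
  have bound: "p \<le> exp (l * e - l * ((1 - pi\<^sup>2 / (8 * real m)) * t) + l\<^sup>2 * pi\<^sup>2 * b\<^sup>2 / 8)" if m: "0 < m" for m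
  proof -
    define c where "c = cos (pi / (2 * real m)) ^ m"
    have "0 < pi / (2 * real m)" "pi / (2 * real m) \<le> pi / 2"
      using m by (auto simp: field_simps)
    then have "0 \<le> cos (pi / (2 * real m))"
      by (intro cos_ge_zero) linarith+
    then have "0 \<le> c" by (simp add: c_def)
    have "ennreal (p * exp (l * (c * t))) = (\<integral>\<^sup>+y. ennreal (exp (l * (c * t))) * indicator {x. t \<le> \<phi> x} y \<partial>gaussian)"
      by (simp add: nn_integral_cmult p_def gaussian.emeasure_eq_measure ennreal_mult mult.commute)
    also have "\<dots> \<le> (\<integral>\<^sup>+y. ennreal (exp (l * (c * \<phi> y))) \<partial>gaussian)"
      using l \<open>0 \<le> c\<close> by (intro nn_integral_mono) (auto simp: indicator_def intro!: ennreal_leI mult_left_mono)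
    finally have "ennreal (p * exp (l * (c * t))) * ennreal (exp (- (l * e)))
      \<le> (\<integral>\<^sup>+y. ennreal (exp (l * (c * \<phi> y))) \<partial>gaussian) * (\<integral>\<^sup>+x. ennreal (exp (- (l * \<phi> x))) \<partial>gaussian)"
      using jensen by (intro mult_mono) auto
    also have "\<dots> \<le> ennreal (exp (l\<^sup>2 * pi\<^sup>2 * b\<^sup>2 / 8))"
      using active_decoupled_mgf[OF us b l m] by (simp add: c_def \<phi>_def)
    finally have "p * exp (l * (c * t) - l * e) \<le> exp (l\<^sup>2 * pi\<^sup>2 * b\<^sup>2 / 8)"
      by (simp add: ennreal_mult[symmetric] p_def exp_diff exp_minus field_simps)
    then have "p \<le> exp (l\<^sup>2 * pi\<^sup>2 * b\<^sup>2 / 8) / exp (l * (c * t) - l * e)"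
      by (simp add: pos_le_divide_eq)
    also have "\<dots> = exp (l * e - l * (c * t) + l\<^sup>2 * pi\<^sup>2 * b\<^sup>2 / 8)"
      by (simp add: exp_diff[symmetric])
    also have "\<dots> \<le> exp (l * e - l * ((1 - pi\<^sup>2 / (8 * real m)) * t) + l\<^sup>2 * pi\<^sup>2 * b\<^sup>2 / 8)"
      using cos_power_ge[OF m] l t by (simp add: c_def mult_left_mono mult_right_mono)
    finally show ?thesis .
  qed
  have "p \<le> exp (l * e - l * t + l\<^sup>2 * pi\<^sup>2 * b\<^sup>2 / 8)"
    by (rule le_exp_limit) (rule bound)
  then show ?thesis unfolding p_def \<phi>_def .
qed

section \<open>Gaussian concentration for sublinear functions\<close>

text \<open>
  Separate x from the convex set on which f is smaller than f x and normalise the separating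
  functional at x. When f x = 0, the zero functional serves.
\<close>

lemma sublinear_subgradient:
  fixes f :: "'a::euclidean_space \<Rightarrow> real"
  assumes nonneg: "\<And>x. 0 \<le> f x" and add: "\<And>x y. f (x + y) \<le> f x + f y"
    and hom: "\<And>c x. 0 < c \<Longrightarrow> f (c *\<^sub>R x) = c * f x" and bound: "\<And>x. f x \<le> b * norm x"
  obtains u where "u \<bullet> x = f x" "\<And>y. u \<bullet> y \<le> f y" "norm u \<le> b"
proof -
  have "f 0 = 0"
    using nonneg[of 0] bound[of 0] by simp
  then have hom0: "f (c *\<^sub>R x) = c * f x" if "0 \<le> c" for c x
    using hom[of c x] that by (cases "c = 0") auto
  have "\<exists>u. u \<bullet> x = f x \<and> (\<forall>y. u \<bullet> y \<le> f y)"
  proof (cases "f x = 0")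
    case True
    then show ?thesis using nonneg by (intro exI[of _ 0]) simp
  next
    case False
    then have fx: "0 < f x" using nonneg[of x] by simp
    define C where "C = {y. f y < f x}"
    have "convex C"
    proof (rule convexI)
      fix y z and u v :: real
      assume "y \<in> C" "z \<in> C" "0 \<le> u" "0 \<le> v" "u + v = 1"
      then have "max (f y) (f z) < f x" by (simp add: C_def)
      have "f (u *\<^sub>R y + v *\<^sub>R z) \<le> u * f y + v * f z"
        using add[of "u *\<^sub>R y" "v *\<^sub>R z"] hom0 \<open>0 \<le> u\<close> \<open>0 \<le> v\<close> by simp
      also have "\<dots> \<le> u * max (f y) (f z) + v * max (f y) (f z)"
        using \<open>0 \<le> u\<close> \<open>0 \<le> v\<close> by (intro add_mono mult_left_mono) auto
      also have "\<dots> = max (f y) (f z)"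
        using \<open>u + v = 1\<close> by (metis distrib_right mult_1)
      finally show "u *\<^sub>R y + v *\<^sub>R z \<in> C"
        using \<open>max (f y) (f z) < f x\<close> unfolding C_def by (simp only: mem_Collect_eq le_less_trans)
    qed
    moreover have "0 \<in> C"
      using fx \<open>f 0 = 0\<close> by (simp add: C_def)
    moreover have "x \<notin> C"
      by (simp add: C_def)
    ultimately obtain a \<beta> where a: "a \<noteq> 0" "\<And>y. y \<in> C \<Longrightarrow> a \<bullet> y \<le> \<beta>" "\<beta> \<le> a \<bullet> x"
      using separating_hyperplane_sets[of C "{x}"] by auto
    have le_ax: "a \<bullet> y \<le> a \<bullet> x" if "y \<in> C" for y
      using a(2)[OF that] a(3) by simp
    have "0 < a \<bullet> x"
    proof -
      define \<epsilon> where "\<epsilon> = f x / (f a + 1)"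
      have "0 < \<epsilon>"
        using fx nonneg[of a] by (simp add: \<epsilon>_def)
      have "\<epsilon> * f a < f x"
        using fx nonneg[of a] by (simp add: \<epsilon>_def field_simps)
      then have "\<epsilon> *\<^sub>R a \<in> C"
        using hom[OF \<open>0 < \<epsilon>\<close>] by (simp add: C_def)
      then have "\<epsilon> * (a \<bullet> a) \<le> a \<bullet> x"
        using le_ax[of "\<epsilon> *\<^sub>R a"] by simp
      moreover have "0 < \<epsilon> * (a \<bullet> a)"
        using \<open>0 < \<epsilon>\<close> a(1) by simp
      ultimately show ?thesis by linarith
    qed
    define u where "u = (f x / (a \<bullet> x)) *\<^sub>R a"
    have "u \<bullet> y \<le> f y" for y
    proof (rule field_le_epsilon)
      fix e :: real assume "0 < e"
      define \<tau> where "\<tau> = f y + e"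
      have \<tau>: "0 < \<tau>" "f y < \<tau>"
        using nonneg[of y] \<open>0 < e\<close> by (auto simp: \<tau>_def)
      have "f x * f y / \<tau> < f x"
        using \<tau> fx by (simp add: field_simps)
      then have "(f x / \<tau>) *\<^sub>R y \<in> C"
        using hom[of "f x / \<tau>" y] fx \<tau> by (simp add: C_def)
      then have "f x / \<tau> * (a \<bullet> y) \<le> a \<bullet> x"
        using le_ax[of "(f x / \<tau>) *\<^sub>R y"] by simp
      then have "u \<bullet> y \<le> \<tau>"
        using \<tau> \<open>0 < a \<bullet> x\<close> by (simp add: u_def field_simps)
      then show "u \<bullet> y \<le> f y + e"
        by (simp add: \<tau>_def)
    qed
    moreover have "u \<bullet> x = f x"
      using \<open>0 < a \<bullet> x\<close> by (simp add: u_def)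
    ultimately show ?thesis by blast
  qed
  then obtain u where u: "u \<bullet> x = f x" "\<And>y. u \<bullet> y \<le> f y" by blast
  have "norm u * norm u \<le> b * norm u"
    using u(2)[of u] bound[of u] by (simp add: power2_norm_eq_inner[symmetric] power2_eq_square)
  moreover have "0 \<le> b" if "u = 0"
  proof -
    obtain z :: 'a where "z \<in> Basis" by (metis SOME_Basis)
    then show ?thesis using nonneg[of z] bound[of z] by simp
  qed
  ultimately have "norm u \<le> b"
    by (cases "u = 0") auto
  then show thesis using that u by blast
qed

text \<open>
  Subgradients at the points of a countable dense set suffice, since f and all subgradients are
  Lipschitz with constant b.
\<close>

lemma sublinear_eq_countable_sup:
  fixes f :: "'a::euclidean_space \<Rightarrow> real"
  assumes nonneg: "\<And>x. 0 \<le> f x" and add: "\<And>x y. f (x + y) \<le> f x + f y"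
    and hom: "\<And>c x. 0 < c \<Longrightarrow> f (c *\<^sub>R x) = c * f x" and bound: "\<And>x. f x \<le> b * norm x" and b: "0 < b"
  obtains u :: "nat \<Rightarrow> 'a" where "\<And>k. norm (u k) \<le> b" "\<And>k x. u k \<bullet> x \<le> f x"
    "\<And>x t. t < f x \<Longrightarrow> \<exists>k. t < u k \<bullet> x"
proof -
  obtain D :: "'a set" where D: "countable D" "\<And>X. open X \<Longrightarrow> X \<noteq> {} \<Longrightarrow> \<exists>d\<in>D. d \<in> X"
    by (rule countable_dense_setE) blast
  then have "D \<noteq> {}" using open_UNIV by blast
  have "\<exists>u. u \<bullet> x = f x \<and> (\<forall>y. u \<bullet> y \<le> f y) \<and> norm u \<le> b" for x
    by (rule sublinear_subgradient[of f b x, OF assms(1-4)]) auto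
  then obtain g where g: "\<And>x. g x \<bullet> x = f x" "\<And>x y. g x \<bullet> y \<le> f y" "\<And>x. norm (g x) \<le> b"
    by metis
  show thesis
  proof (rule that[of "\<lambda>k. g (from_nat_into D k)"])
    fix x t assume "t < f x"
    \<comment> \<open>Moving from x to d costs \<open>b * dist x d\<close> in f and the same amount in the functional.\<close>
    define \<epsilon> where "\<epsilon> = (f x - t) / (2 * b)"
    have "0 < \<epsilon>" using \<open>t < f x\<close> b by (simp add: \<epsilon>_def)
    then obtain d where d: "d \<in> D" "dist x d < \<epsilon>"
      using D(2)[of "ball x \<epsilon>"] by auto
    have "f x \<le> f d + f (x - d)"
      using add[of d "x - d"] by simp
    also have "f d = g d \<bullet> x + g d \<bullet> (d - x)"
      by (simp add: g(1)[symmetric] inner_diff_right)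
    also have "g d \<bullet> (d - x) \<le> b * dist x d"
      using order_trans[OF g(2) bound, of d "d - x"] by (simp add: dist_norm norm_minus_commute)
    also have "f (x - d) \<le> b * dist x d"
      using bound[of "x - d"] by (simp add: dist_norm)
    also have "b * dist x d < (f x - t) / 2"
      using d(2) b by (simp add: \<epsilon>_def field_simps)
    finally have "t < g d \<bullet> x" by simp
    moreover obtain k where "from_nat_into D k = d"
      using from_nat_into_surj[OF D(1) d(1)] by blast
    ultimately show "\<exists>k. t < g (from_nat_into D k) \<bullet> x" by blast
  qed (rule g)+
qed

lemma sublinear_continuous:
  fixes f :: "'a::euclidean_space \<Rightarrow> real"
  assumes add: "\<And>x y. f (x + y) \<le> f x + f y" and bound: "\<And>x. f x \<le> b * norm x"
  shows "continuous_on UNIV f"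
proof -
  have diff_le: "f x - f y \<le> \<bar>b\<bar> * dist x y" for x y
    using add[of y "x - y"] bound[of "x - y"] mult_right_mono[OF abs_ge_self[of b], of "dist x y"]
    by (simp add: dist_norm)
  have "\<bar>f x - f y\<bar> \<le> \<bar>b\<bar> * dist x y" for x y
    using diff_le[of x y] diff_le[of y x] by (simp add: abs_le_iff dist_commute)
  then have "\<bar>b\<bar>-lipschitz_on UNIV f"
    by (intro lipschitz_onI) (simp_all add: dist_norm)
  then show ?thesis by (rule lipschitz_on_continuous_on)
qed

text \<open>
  A nonnegative sublinear function is the increasing limit of the maxima of finitely many of its
  subgradients, whose means are at most that of f, so \<open>active_tail\<close> passes to the limit.
\<close>

theorem gaussian_sublinear_tail:
  fixes f :: "'a::euclidean_space \<Rightarrow> real"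
  assumes nonneg: "\<And>x. 0 \<le> f x" and add: "\<And>x y. f (x + y) \<le> f x + f y"
    and hom: "\<And>c x. 0 < c \<Longrightarrow> f (c *\<^sub>R x) = c * f x" and bound: "\<And>x. f x \<le> b * norm x" and b: "0 < b"
    and t: "(\<integral>x. f x \<partial>gaussian) \<le> t"
  shows "measure gaussian {x. t < f x} \<le> exp (- (2 * (t - (\<integral>x. f x \<partial>gaussian))\<^sup>2 / (pi\<^sup>2 * b\<^sup>2)))"
proof -
  define e where "e = (\<integral>x. f x \<partial>gaussian)"
  \<comment> \<open>The minimiser of the exponent \<open>l * e - l * t + l\<^sup>2 * pi\<^sup>2 * b\<^sup>2 / 8\<close>.\<close>
  define l where "l = 4 * (t - e) / (pi\<^sup>2 * b\<^sup>2)"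
  have "0 \<le> l" using t by (simp add: l_def e_def)
  have f_meas [measurable]: "f \<in> borel_measurable borel"
    by (intro borel_measurable_continuous_onI sublinear_continuous[of f b] add bound)
  have "0 \<le> e"
    unfolding e_def by (intro Bochner_Integration.integral_nonneg nonneg)
  then have "0 \<le> t" using t by (simp add: e_def)
  have f_int: "integrable gaussian f"
    using nonneg bound by (intro norm_bounded_integrable[of f b]) auto
  obtain u :: "nat \<Rightarrow> 'a" where u: "\<And>k. norm (u k) \<le> b" "\<And>k x. u k \<bullet> x \<le> f x"
    "\<And>x t. t < f x \<Longrightarrow> \<exists>k. t < u k \<bullet> x"
    using sublinear_eq_countable_sup[of f b, OF nonneg add hom bound b] by metis
  define us where "us k = map u [0..<k]" for k
  define \<phi> where "\<phi> k x = active (us k) x \<bullet> x" for k x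
  have [measurable]: "\<phi> k \<in> borel_measurable borel" for k
    unfolding \<phi>_def by measurable
  have us: "v \<in> set (us k) \<Longrightarrow> norm v \<le> b" for k v
    by (auto simp: us_def u)
  have phi_le: "\<phi> k x \<le> f x" for k x
    using active_mem[of "us k" x] nonneg[of x] u(2)[of _ x] by (auto simp: \<phi>_def us_def)
  have mono: "\<phi> k x \<le> \<phi> (Suc k) x" for k x
    using active_mem[of "us k" x] unfolding \<phi>_def
    by (intro active_ge) (auto simp: us_def)
  have "measure gaussian {x. t < \<phi> k x} \<le> exp (l * e - l * t + l\<^sup>2 * pi\<^sup>2 * b\<^sup>2 / 8)" for k
  proof -
    have "\<bar>\<phi> k x\<bar> \<le> b * norm x" for x
      using order_trans[OF phi_le bound] active_nonneg[of "us k" x] by (simp add: \<phi>_def)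
    then have "(\<integral>x. \<phi> k x \<partial>gaussian) \<le> e"
      unfolding e_def by (intro integral_mono f_int phi_le norm_bounded_integrable) auto
    then have "l * (\<integral>x. \<phi> k x \<partial>gaussian) \<le> l * e"
      using \<open>0 \<le> l\<close> by (rule mult_left_mono)
    have "measure gaussian {x. t < \<phi> k x} \<le> measure gaussian {x. t \<le> \<phi> k x}"
      by (intro gaussian.finite_measure_mono) auto
    also have "\<dots> \<le> exp (l * (\<integral>x. \<phi> k x \<partial>gaussian) - l * t + l\<^sup>2 * pi\<^sup>2 * b\<^sup>2 / 8)"
      unfolding \<phi>_def using b by (intro active_tail us \<open>0 \<le> l\<close> \<open>0 \<le> t\<close>) auto
    also have "\<dots> \<le> exp (l * e - l * t + l\<^sup>2 * pi\<^sup>2 * b\<^sup>2 / 8)"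
      using \<open>l * (\<integral>x. \<phi> k x \<partial>gaussian) \<le> l * e\<close> by simp
    finally show ?thesis .
  qed
  moreover have "(\<lambda>k. measure gaussian {x. t < \<phi> k x}) \<longlonglongrightarrow> measure gaussian (\<Union>k. {x. t < \<phi> k x})"
    by (intro gaussian.finite_Lim_measure_incseq)
       (auto simp: incseq_Suc_iff intro: less_le_trans[OF _ mono])
  moreover have "(\<Union>k. {x. t < \<phi> k x}) = {x. t < f x}"
  proof (intro set_eqI iffI)
    fix x assume "x \<in> {x. t < f x}"
    then obtain k where "t < u k \<bullet> x" using u(3) by blast
    also have "u k \<bullet> x \<le> \<phi> (Suc k) x"
      unfolding \<phi>_def by (intro active_ge) (simp add: us_def)
    finally show "x \<in> (\<Union>k. {x. t < \<phi> k x})" by blast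
  qed (auto intro: less_le_trans[OF _ phi_le])
  ultimately have "measure gaussian {x. t < f x} \<le> exp (l * e - l * t + l\<^sup>2 * pi\<^sup>2 * b\<^sup>2 / 8)"
    by (auto intro: LIMSEQ_le_const2)
  also have "l * e - l * t + l\<^sup>2 * pi\<^sup>2 * b\<^sup>2 / 8 = - (2 * (t - e)\<^sup>2 / (pi\<^sup>2 * b\<^sup>2))"
    using b by (simp add: l_def power2_eq_square field_simps)
  finally show ?thesis by (simp add: e_def)
qed

section \<open>Random subspaces and Gaussian vectors\<close>

lemma closest_point_orthogonal:
  fixes E :: "'a::euclidean_space set"
  assumes "subspace E" "z \<in> E"
  shows "(x - closest_point E x) \<bullet> z = 0"
proof -
  have "span E = E" using assms(1) by (simp add: span_eq_iff)
  then obtain y w where yw: "y \<in> E" "\<And>v. v \<in> E \<Longrightarrow> orthogonal w v" "x = y + w"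
    using orthogonal_subspace_decomp_exists[of E x] by metis
  then have "closest_point E x = y"
    by (intro closest_point_subspace_eqI assms) (auto simp: orthogonal_def)
  then show ?thesis
    using yw(2)[OF assms(2)] yw(3) by (simp add: orthogonal_def)
qed

lemma closest_point_subspace_mem:
  fixes E :: "'a::euclidean_space set"
  assumes "subspace E"
  shows "closest_point E x \<in> E"
  using closest_point_in_set[OF closed_subspace[OF assms]] subspace_0[OF assms] by blast

lemma closest_point_orthogonal_image:
  fixes T :: "'a::euclidean_space \<Rightarrow> 'a"
  assumes T: "orthogonal_transformation T" and E: "subspace E"
  shows "closest_point (T ` E) (T x) = T (closest_point E x)"
proof (rule closest_point_subspace_eqI)
  have lin: "linear T" using T by (simp add: orthogonal_transformation_def)
  show "subspace (T ` E)"
    using lin E by (rule linear_subspace_image)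
  show "T (closest_point E x) \<in> T ` E"
    using closest_point_subspace_mem[OF E] by blast
  fix z assume "z \<in> T ` E"
  then obtain w where w: "w \<in> E" "z = T w" by blast
  have "(T x - T (closest_point E x)) \<bullet> T w = (x - closest_point E x) \<bullet> w"
    using T by (simp add: linear_diff[OF lin, symmetric] orthogonal_transformation_def)
  then show "(T x - T (closest_point E x)) \<bullet> z = 0"
    using closest_point_orthogonal[OF E w(1)] w(2) by simp
qed

lemma matrix_closest_point:
  fixes E :: "(real^'n) set"
  assumes "subspace E"
  shows "matrix (closest_point E) *v x = closest_point E x"
  by (simp only: matrix_vector_mul(2)[OF linear_closest_point[OF assms]])

lemma openin_grassmannian_subset:
  "{U. openin (grassmannian_topology k) U} \<subseteq> Pow (grassmannian k)"
  by (auto simp: grassmannian_topology_def openin_pullback_topology)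

lemma space_grassmannian_borel [simp]:
  "space (grassmannian_borel k :: (real^'n) set measure) = grassmannian k"
  unfolding grassmannian_borel_def
  by (rule space_measure_of[OF openin_grassmannian_subset])

lemma matrix_closest_point_measurable [measurable]:
  "(\<lambda>E. matrix (closest_point E)) \<in> borel_measurable (grassmannian_borel k :: (real^'n) set measure)"
proof (rule borel_measurableI)
  fix U :: "(real^'n^'n) set" assume "open U"
  then have "openin (grassmannian_topology k) ((\<lambda>E. matrix (closest_point E)) -` U \<inter> grassmannian k)"
    unfolding grassmannian_topology_def by (auto simp: openin_pullback_topology)
  then show "(\<lambda>E. matrix (closest_point E)) -` U \<inter> space (grassmannian_borel k) \<in> sets (grassmannian_borel k)"
    unfolding space_grassmannian_borel unfolding grassmannian_borel_def
    by (intro in_measure_of[OF openin_grassmannian_subset]) simp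
qed

lemma grassmannian_borel_measurableI:
  fixes f :: "'a \<Rightarrow> (real^'n) set"
  assumes f: "f \<in> space N \<rightarrow> grassmannian k"
    and meas: "(\<lambda>\<omega>. matrix (closest_point (f \<omega>))) \<in> borel_measurable N"
  shows "f \<in> N \<rightarrow>\<^sub>M (grassmannian_borel k :: (real^'n) set measure)"
  unfolding grassmannian_borel_def
proof (rule measurable_measure_of[OF openin_grassmannian_subset f])
  fix S :: "(real^'n) set set" assume "S \<in> {U. openin (grassmannian_topology k) U}"
  then obtain U where U: "open U" "S = (\<lambda>E. matrix (closest_point E)) -` U \<inter> grassmannian k"
    by (auto simp: grassmannian_topology_def openin_pullback_topology)
  then have "f -` S \<inter> space N = (\<lambda>\<omega>. matrix (closest_point (f \<omega>))) -` U \<inter> space N"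
    using f by auto
  also have "\<dots> \<in> sets N"
    using U(1) by (intro measurable_sets[OF meas]) simp
  finally show "f -` S \<inter> space N \<in> sets N" .
qed

lemma orthogonal_image_grassmannian:
  fixes T :: "'a::euclidean_space \<Rightarrow> 'a"
  assumes T: "orthogonal_transformation T" and E: "E \<in> grassmannian k"
  shows "T ` E \<in> grassmannian k"
proof -
  have lin: "linear T" and inj: "inj T"
    using T orthogonal_transformation_inj by (auto simp: orthogonal_transformation_def)
  have "dim (T ` E) = dim E"
    using lin inj by (intro dim_image_eq) (auto intro: inj_on_subset)
  then show ?thesis
    using E linear_subspace_image[OF lin] by (auto simp: grassmannian_def)
qed

text \<open>
  The projection onto T ` E is the conjugate by T of the projection onto E, which depends continuously
  on the latter.
\<close>

lemma orthogonal_image_measurable: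
  fixes T :: "real^'n \<Rightarrow> real^'n"
  assumes T: "orthogonal_transformation T"
  shows "(\<lambda>E. T ` E) \<in> grassmannian_borel k \<rightarrow>\<^sub>M grassmannian_borel k"
proof (rule grassmannian_borel_measurableI)
  show "(\<lambda>E. T ` E) \<in> space (grassmannian_borel k) \<rightarrow> grassmannian k"
    using orthogonal_image_grassmannian[OF T] by auto
  have lin: "linear T" using T by (simp add: orthogonal_transformation_def)
  have eq: "matrix (closest_point (T ` E)) = matrix T ** matrix (closest_point E) ** matrix (inv T)"
    if "E \<in> grassmannian k" for E
  proof -
    have E: "subspace E" using that by (simp add: grassmannian_def)
    have bij: "bij T" using T by (rule orthogonal_transformation_bij)
    have lin': "linear (inv T)"
      using orthogonal_transformation_inv[OF T] by (simp add: orthogonal_transformation_def)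
    have "closest_point (T ` E) = T \<circ> closest_point E \<circ> inv T"
    proof
      fix x
      have "x = T (inv T x)" using bij by (simp add: bij_is_surj surj_f_inv_f)
      then show "closest_point (T ` E) x = (T \<circ> closest_point E \<circ> inv T) x"
        using closest_point_orthogonal_image[OF T E, of "inv T x"] by simp
    qed
    then show ?thesis
      using lin lin' linear_closest_point[OF E]
      by (simp add: matrix_compose linear_compose matrix_mul_assoc)
  qed
  have "continuous_on UNIV (\<lambda>M::real^'n^'n. matrix T ** M ** matrix (inv T))"
    unfolding matrix_matrix_mult_def by (intro continuous_intros)
  then have "(\<lambda>E. matrix T ** matrix (closest_point E) ** matrix (inv T))
    \<in> borel_measurable (grassmannian_borel k)"
    by (rule borel_measurable_continuous_on) measurable
  then show "(\<lambda>E. matrix (closest_point (T ` E))) \<in> borel_measurable (grassmannian_borel k)"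
    by (subst measurable_cong[OF eq]) auto
qed

text \<open>
  The reflection in the hyperplane orthogonal to the difference v of the two unit vectors exchanges
  them, and it commutes with the projection onto F because v lies in F. If v = 0, the formula gives
  the identity, by the convention for division by zero.
\<close>

lemma reflection_in_subspace:
  fixes F :: "'a::euclidean_space set"
  assumes F: "subspace F" and w: "w \<in> F" "w' \<in> F" "w \<noteq> 0" "w' \<noteq> 0"
  obtains T where "orthogonal_transformation T" "T w = (norm w / norm w') *\<^sub>R w'"
    "\<And>x. closest_point F (T x) = T (closest_point F x)"
proof -
  define v where "v = w /\<^sub>R norm w - w' /\<^sub>R norm w'"
  define T where "T x = x - (2 * (x \<bullet> v) / (v \<bullet> v)) *\<^sub>R v" for x
  have v: "v \<in> F"
    using F w by (simp add: v_def subspace_diff subspace_scale)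
  have "linear T"
    by (simp add: linear_iff T_def inner_simps add_divide_distrib algebra_simps)
  moreover have "T x \<bullet> T y = x \<bullet> y" for x y
    by (cases "v = 0") (simp_all add: T_def inner_simps inner_commute field_simps)
  ultimately have T: "orthogonal_transformation T"
    by (simp add: orthogonal_transformation_def)
  have "T w = (norm w / norm w') *\<^sub>R w'"
  proof (cases "v = 0")
    case True
    then have "w /\<^sub>R norm w = w' /\<^sub>R norm w'" by (simp add: v_def)
    then have "norm w *\<^sub>R (w /\<^sub>R norm w) = norm w *\<^sub>R (w' /\<^sub>R norm w')" by simp
    then have "w = (norm w / norm w') *\<^sub>R w'"
      using w by (simp add: divide_inverse)
    moreover have "T w = w" using True by (simp add: T_def)
    ultimately show ?thesis by simp
  next
    case False
    have unit: "(w /\<^sub>R norm w) \<bullet> (w /\<^sub>R norm w) = 1" "(w' /\<^sub>R norm w') \<bullet> (w' /\<^sub>R norm w') = 1"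
      using w by (simp_all add: power2_norm_eq_inner[symmetric] power2_eq_square)
    have "v \<bullet> v = 2 * ((w /\<^sub>R norm w) \<bullet> v)"
      using unit unfolding v_def inner_diff_left inner_diff_right
      by (simp add: inner_commute)
    also have "\<dots> = 2 * (w \<bullet> v) / norm w"
      by (simp add: divide_inverse mult.commute)
    finally have "2 * (w \<bullet> v) / (v \<bullet> v) = norm w"
      using False w by (simp add: field_simps)
    then have "T w = w - norm w *\<^sub>R v"
      by (simp add: T_def)
    also have "\<dots> = (norm w / norm w') *\<^sub>R w'"
      using w by (simp add: v_def scaleR_diff_right divide_inverse)
    finally show ?thesis .
  qed
  moreover have "closest_point F (T x) = T (closest_point F x)" for x
  proof -
    have "x \<bullet> v = closest_point F x \<bullet> v"
      using closest_point_orthogonal[OF F v, of x] by (simp add: inner_diff_left)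
    moreover have "closest_point F v = v"
      using v by (rule closest_point_self)
    ultimately show ?thesis
      by (simp add: T_def linear_diff[OF linear_closest_point[OF F]] linear_cmul[OF linear_closest_point[OF F]])
  qed
  ultimately show thesis using that T by blast
qed

lemma subspaces_meet:
  fixes E F :: "'a::euclidean_space set"
  assumes "subspace E" "subspace F" "DIM('a) < dim E + dim F"
  obtains w where "w \<in> E" "w \<in> F" "w \<noteq> 0"
proof -
  have "dim {x + y |x y. x \<in> E \<and> y \<in> F} + dim (E \<inter> F) = dim E + dim F"
    using assms(1,2) by (rule dim_sums_Int)
  moreover have "dim {x + y |x y. x \<in> E \<and> y \<in> F} \<le> DIM('a)"
    by (rule dim_subset_UNIV)
  ultimately have "dim (E \<inter> F) \<noteq> 0" using assms(3) by linarith
  then have "\<not> E \<inter> F \<subseteq> {0}" by (simp add: dim_eq_0)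
  then show thesis using that by blast
qed

text \<open>
  A coupling of the random subspace E with a Gaussian vector x, under which the projection w of x to F
  is always \<delta>-close to E in angle. Let k(E, x) indicate this closeness and let h be k divided by its
  Gaussian integral Z E over x; Z E is positive because E meets F outside 0. The function h is invariant
  under applying to E and x an orthogonal transformation that commutes with the projection to F, and
  it depends on x only through the direction of w. Hence its integral over E is the same for all x
  with w \<noteq> 0, by the reflections above, and vanishes for w = 0. The double integral of h is 1 because h
  integrates to 1 over x, so this constant is at least 1. Thus h is the density of a measure on pairs
  (E, x) with first marginal \<mu> and second marginal at least Gaussian outside w = 0, and the event B
  for x forces the event A for E on its support.
\<close>

lemma haar_grassmannian_ge_gaussian:
  fixes F :: "(real^'n) set" and \<mu> :: "(real^'n) set measure"
  assumes haar: "haar_grassmannian k \<mu>" and F: "subspace F" and dims: "CARD('n) < k + dim F"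
    and \<delta>: "0 < \<delta>" and B: "B \<in> sets borel" and A: "A \<in> sets \<mu>"
    and B0: "\<And>x. x \<in> B \<Longrightarrow> closest_point F x \<noteq> 0"
    and AB: "\<And>E x. E \<in> grassmannian k \<Longrightarrow> x \<in> B
      \<Longrightarrow> norm (closest_point F x - closest_point E (closest_point F x)) < \<delta> * norm (closest_point F x)
      \<Longrightarrow> E \<in> A"
  shows "measure gaussian B \<le> measure \<mu> A"
proof -
  define P where "P = closest_point F"
  interpret \<mu>: prob_space \<mu> using haar by (simp add: haar_grassmannian_def)
  have sets_mu [measurable_cong]: "sets \<mu> = sets (grassmannian_borel k)"
    using haar by (simp add: haar_grassmannian_def)
  then have space_mu: "space \<mu> = grassmannian k"
    using sets_eq_imp_space_eq space_grassmannian_borel by metis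
  have lin: "linear P" unfolding P_def using F by (rule linear_closest_point)
  then have [measurable]: "P \<in> borel_measurable borel" by (rule linear_borel_measurable)
  have P_F: "P x \<in> F" for x unfolding P_def by (rule closest_point_subspace_mem[OF F])
  define k' where "k' E x = (if norm (P x - closest_point E (P x)) < \<delta> * norm (P x) then 1 else 0 :: ennreal)" for E x
  have k'_meas: "(\<lambda>(E, x). k' E x) \<in> borel_measurable (grassmannian_borel k \<Otimes>\<^sub>M borel)"
  proof -
    have cont: "continuous_on UNIV (\<lambda>p::(real^'n^'n) \<times> (real^'n). fst p *v snd p)"
      unfolding matrix_vector_mult_def by (intro continuous_intros)
    have [measurable]: "(\<lambda>p. matrix (closest_point (fst p)) *v P (snd p))
      \<in> borel_measurable ((grassmannian_borel k :: (real^'n) set measure) \<Otimes>\<^sub>M (borel :: (real^'n) measure))"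
      by (rule borel_measurable_continuous_Pair[OF _ _ cont]) measurable
    have "(\<lambda>p. if norm (P (snd p) - matrix (closest_point (fst p)) *v P (snd p)) < \<delta> * norm (P (snd p)) then 1 else 0 :: ennreal)
      \<in> borel_measurable ((grassmannian_borel k :: (real^'n) set measure) \<Otimes>\<^sub>M (borel :: (real^'n) measure))"
      by measurable
    then show ?thesis
      by (rule measurable_cong[THEN iffD1, rotated])
         (auto simp: space_pair_measure k'_def matrix_closest_point grassmannian_def)
  qed
  define Z where "Z E = (\<integral>\<^sup>+x. k' E x \<partial>gaussian)" for E
  define h where "h E x = k' E x / Z E" for E x
  have k'_meas1 [measurable]: "(\<lambda>(E, x). k' E x) \<in> borel_measurable (\<mu> \<Otimes>\<^sub>M gaussian)"
    using k'_meas by (simp cong: measurable_cong_sets sets_pair_measure_cong add: sets_mu)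
  have Z_meas [measurable]: "Z \<in> borel_measurable \<mu>"
    unfolding Z_def by measurable
  have h_meas [measurable]: "(\<lambda>(E, x). h E x) \<in> borel_measurable (\<mu> \<Otimes>\<^sub>M gaussian)"
    unfolding h_def by measurable
  have [measurable]: "(\<lambda>p. h (fst p) (snd p)) \<in> borel_measurable (\<mu> \<Otimes>\<^sub>M gaussian)"
    using h_meas by (simp add: case_prod_beta')
  have [measurable]: "B \<in> sets borel" by (rule B)
  have k'_x_meas [measurable]: "k' E \<in> borel_measurable borel" if "E \<in> grassmannian k" for E
    using measurable_Pair2[OF k'_meas1, of E] that by (simp add: space_mu)
  have Z_nz: "Z E \<noteq> 0" and Z_fin: "Z E \<noteq> \<infinity>" if "E \<in> grassmannian k" for E
  proof -
    have E: "subspace E" "dim E = k" using that by (auto simp: grassmannian_def)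
    obtain w where w: "w \<in> E" "w \<in> F" "w \<noteq> 0"
      using subspaces_meet[OF E(1) F] dims E(2) by auto
    define U where "U = {x. norm (P x - closest_point E (P x)) < \<delta> * norm (P x)}"
    have "open U"
    proof -
      have "linear (closest_point E \<circ> P)"
        using linear_compose[OF lin linear_closest_point[OF E(1)]] .
      then have "continuous_on UNIV (\<lambda>x. closest_point E (P x))"
        unfolding comp_def by (simp add: linear_continuous_on linear_conv_bounded_linear)
      moreover have "continuous_on UNIV P"
        using lin by (simp add: linear_continuous_on linear_conv_bounded_linear)
      ultimately show ?thesis
        unfolding U_def
        by (intro open_Collect_less continuous_on_norm continuous_on_diff continuous_on_mult
            continuous_on_const)
    qed
    moreover have "w \<in> U"
      using w \<delta> by (simp add: U_def P_def closest_point_self)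
    ultimately have "0 < emeasure gaussian U"
      by (intro gaussian_open_pos) auto
    moreover have Z_eq: "Z E = emeasure gaussian U"
    proof -
      have "Z E = (\<integral>\<^sup>+x. indicator U x \<partial>gaussian)"
        unfolding Z_def k'_def by (intro nn_integral_cong) (auto simp: U_def)
      then show ?thesis using \<open>open U\<close> by simp
    qed
    ultimately show "Z E \<noteq> 0" by simp
    show "Z E \<noteq> \<infinity>"
      unfolding Z_eq by simp
  qed
  have h_int: "(\<integral>\<^sup>+x. h E x \<partial>gaussian) = 1" if "E \<in> grassmannian k" for E
    using Z_nz[OF that] Z_fin[OF that] k'_x_meas[OF that]
    by (simp add: h_def nn_integral_divide Z_def[symmetric] ennreal_divide_self less_top)
  define K where "K x = (\<integral>\<^sup>+E. h E x \<partial>\<mu>)" for x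
  have h_inv: "h (T ` E) x' = h E x"
    if T: "orthogonal_transformation T" "\<And>x. P (T x) = T (P x)" and E: "E \<in> grassmannian k"
      and c: "0 < c" "P x' = c *\<^sub>R T (P x)" for T E x x' c
  proof -
    have sub: "subspace E" using E by (simp add: grassmannian_def)
    have linT: "linear T" using T(1) by (simp add: orthogonal_transformation_def)
    have key: "k' (T ` E) y' = k' E y" if "0 < d" "P y' = d *\<^sub>R T (P y)" for d y y'
    proof -
      have "closest_point (T ` E) (P y') = d *\<^sub>R T (closest_point E (P y))"
        using closest_point_orthogonal_image[OF T(1) sub, of "P y"] that(2)
          linear_cmul[OF linear_closest_point[OF linear_subspace_image[OF linT sub]]]
        by simp
      then have "P y' - closest_point (T ` E) (P y') = d *\<^sub>R T (P y - closest_point E (P y))"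
        using that(2) by (simp add: linear_diff[OF linT] scaleR_diff_right)
      then have "norm (P y' - closest_point (T ` E) (P y')) = d * norm (P y - closest_point E (P y))"
        using that(1) by (simp add: orthogonal_transformation_norm[OF T(1)])
      moreover have "norm (P y') = d * norm (P y)"
        using that by (simp add: orthogonal_transformation_norm[OF T(1)])
      ultimately show ?thesis
        using that(1) by (simp add: k'_def mult.left_commute)
    qed
    have "Z (T ` E) = (\<integral>\<^sup>+x. k' (T ` E) (T x) \<partial>gaussian)"
      unfolding Z_def
      by (rule nn_integral_gaussian_orthogonal[OF T(1), symmetric])
         (rule k'_x_meas[OF orthogonal_image_grassmannian[OF T(1) E]])
    also have "\<dots> = Z E"
      unfolding Z_def using key[of 1] T(2) by simp
    finally show ?thesis
      using key[OF c] by (simp add: h_def)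
  qed
  have K_const: "K x' = K x" if nz: "P x \<noteq> 0" "P x' \<noteq> 0" for x x'
  proof -
    obtain T where T: "orthogonal_transformation T" "T (P x) = (norm (P x) / norm (P x')) *\<^sub>R P x'"
      "\<And>y. P (T y) = T (P y)"
      using reflection_in_subspace[OF F P_F P_F nz] unfolding P_def by metis
    have *: "0 < norm (P x') / norm (P x)" "P x' = (norm (P x') / norm (P x)) *\<^sub>R T (P x)"
      using nz T(2) by simp_all
    have h_E_meas: "(\<lambda>E. h E y) \<in> borel_measurable (grassmannian_borel k)" for y
      using measurable_Pair1[OF h_meas, of y] by (simp cong: measurable_cong_sets add: sets_mu)
    have distr: "distr \<mu> (grassmannian_borel k) (\<lambda>E. T ` E) = \<mu>"
      using haar T(1) by (simp add: haar_grassmannian_def)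
    have T_meas: "(\<lambda>E. T ` E) \<in> \<mu> \<rightarrow>\<^sub>M grassmannian_borel k"
      using orthogonal_image_measurable[OF T(1)] by (simp cong: measurable_cong_sets add: sets_mu)
    have "K x' = (\<integral>\<^sup>+E. h E x' \<partial>distr \<mu> (grassmannian_borel k) (\<lambda>E. T ` E))"
      by (simp add: distr K_def)
    also have "\<dots> = (\<integral>\<^sup>+E. h (T ` E) x' \<partial>\<mu>)"
      by (rule nn_integral_distr[OF T_meas]) (simp add: h_E_meas)
    also have "\<dots> = K x"
      unfolding K_def by (intro nn_integral_cong h_inv[OF T(1,3) _ *]) (simp add: space_mu)
    finally show ?thesis .
  qed
  interpret pair_sigma_finite \<mu> "gaussian :: (real^'n) measure" ..
  \<comment> \<open>The integral of h over E is constant off w = 0 and has Gaussian mean 1.\<close>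
  have K_ge: "1 \<le> K x0" if x0: "P x0 \<noteq> 0" for x0
  proof -
    have "1 = (\<integral>\<^sup>+E. (\<integral>\<^sup>+x. h E x \<partial>gaussian) \<partial>\<mu>)"
      using \<mu>.emeasure_space_1 by (subst nn_integral_cong[of \<mu> _ "\<lambda>_. 1"]) (auto simp: h_int space_mu)
    also have "\<dots> = (\<integral>\<^sup>+x. K x \<partial>gaussian)"
      unfolding K_def by (rule Fubini'[symmetric]) measurable
    also have "\<dots> \<le> (\<integral>\<^sup>+x. K x0 \<partial>(gaussian :: (real^'n) measure))"
    proof (rule nn_integral_mono)
      show "K x \<le> K x0" for x
      proof (cases "P x = 0")
        case True
        then have "K x = 0" by (simp add: K_def h_def k'_def)
        then show ?thesis by simp
      next
        case False
        then show ?thesis using K_const[OF x0 False] by simp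
      qed
    qed
    also have "\<dots> = K x0"
      using gaussian.emeasure_space_1[where ?'a = "real^'n"] by simp
    finally show ?thesis .
  qed
  have "emeasure gaussian B = (\<integral>\<^sup>+x. indicator B x \<partial>gaussian)"
    using B by simp
  also have "\<dots> \<le> (\<integral>\<^sup>+x. indicator B x * K x \<partial>gaussian)"
    using K_ge B0 by (intro nn_integral_mono) (auto simp: indicator_def P_def)
  also have "\<dots> = (\<integral>\<^sup>+x. (\<integral>\<^sup>+E. indicator B x * h E x \<partial>\<mu>) \<partial>gaussian)"
    unfolding K_def using measurable_Pair1[OF h_meas] by (simp add: nn_integral_cmult)
  also have "\<dots> = (\<integral>\<^sup>+E. (\<integral>\<^sup>+x. indicator B x * h E x \<partial>gaussian) \<partial>\<mu>)"
    by (intro Fubini') (unfold case_prod_beta', measurable)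
  also have "\<dots> \<le> (\<integral>\<^sup>+E. indicator A E * (\<integral>\<^sup>+x. h E x \<partial>gaussian) \<partial>\<mu>)"
  proof (rule nn_integral_mono)
    fix E assume "E \<in> space \<mu>"
    then have E: "E \<in> grassmannian k" by (simp add: space_mu)
    show "(\<integral>\<^sup>+x. indicator B x * h E x \<partial>gaussian) \<le> indicator A E * (\<integral>\<^sup>+x. h E x \<partial>gaussian)"
    proof (cases "E \<in> A")
      case True
      then show ?thesis by (auto simp: indicator_def intro!: nn_integral_mono)
    next
      case False
      then have zero: "indicator B x * h E x = 0" for x
        using AB[OF E, of x] by (auto simp: indicator_def h_def k'_def P_def)
      show ?thesis by (simp only: zero nn_integral_const mult_zero_left zero_le)
    qed
  qed
  also have "\<dots> = (\<integral>\<^sup>+E. indicator A E \<partial>\<mu>)"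
    by (intro nn_integral_cong) (simp add: h_int space_mu)
  also have "\<dots> = emeasure \<mu> A"
    using A by simp
  finally show ?thesis
    by (simp add: gaussian.emeasure_eq_measure \<mu>.emeasure_eq_measure)
qed

section \<open>Gauges of sections and the random radius\<close>

text \<open>
  What the gauge of \<open>L = K \<inter> F\<close> inherits from a convex body K: L is convex and contains a ball of F
  around 0.
\<close>

locale relative_convex_body =
  fixes F L :: "'a::euclidean_space set" and r :: real
  assumes F: "subspace F" and L_F: "L \<subseteq> F" and convex_L: "convex L" and r: "0 < r"
    and ball_L: "\<And>x. x \<in> F \<Longrightarrow> norm x \<le> r \<Longrightarrow> x \<in> L"
begin

lemma dilate_mono:
  assumes "0 < t" "t \<le> t'" "x \<in> (\<lambda>y. t *\<^sub>R y) ` L"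
  shows "x \<in> (\<lambda>y. t' *\<^sub>R y) ` L"
proof -
  obtain y where y: "y \<in> L" "x = t *\<^sub>R y" using assms(3) by blast
  have "0 \<in> L" using subspace_0[OF F] r by (intro ball_L) auto
  then have "(t / t') *\<^sub>R y + (1 - t / t') *\<^sub>R 0 \<in> L"
    using y(1) assms(1,2) convex_L by (intro convexD) auto
  moreover have "x = t' *\<^sub>R ((t / t') *\<^sub>R y + (1 - t / t') *\<^sub>R 0)"
    using y(2) assms(1,2) by simp
  ultimately show ?thesis by blast
qed

lemma gauge_bdd_below: "bdd_below {t. 0 < t \<and> x \<in> (\<lambda>y. t *\<^sub>R y) ` L}"
  by (rule bdd_belowI[of _ 0]) auto

lemma gauge_le:
  assumes "0 < t" "x \<in> (\<lambda>y. t *\<^sub>R y) ` L"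
  shows "gauge_norm L x \<le> t"
  unfolding gauge_norm_def using assms by (intro cInf_lower gauge_bdd_below) simp

lemma ball_dilate_mem:
  assumes "x \<in> F" "0 < t" "norm x \<le> r * t"
  shows "x \<in> (\<lambda>y. t *\<^sub>R y) ` L"
proof -
  have "(1 / t) *\<^sub>R x \<in> L"
    using assms F by (intro ball_L) (auto simp: subspace_scale field_simps)
  then show ?thesis
    using assms(2) by (intro image_eqI[of _ _ "(1 / t) *\<^sub>R x"]) auto
qed

lemma gauge_set_nonempty:
  assumes "x \<in> F"
  shows "{t. 0 < t \<and> x \<in> (\<lambda>y. t *\<^sub>R y) ` L} \<noteq> {}"
proof -
  have "0 < norm x / r + 1" using r by (simp add: add_nonneg_pos)
  moreover have "norm x \<le> r * (norm x / r + 1)" using r by (simp add: field_simps)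
  ultimately show ?thesis using ball_dilate_mem[OF assms] by blast
qed

lemma gauge_less_mem:
  assumes "x \<in> F" "gauge_norm L x < t"
  shows "0 < t" "x \<in> (\<lambda>y. t *\<^sub>R y) ` L"
proof -
  obtain s where "0 < s" "x \<in> (\<lambda>y. s *\<^sub>R y) ` L" "s < t"
    using assms(2) cInf_lessD[OF gauge_set_nonempty[OF assms(1)]] unfolding gauge_norm_def by blast
  then show "0 < t" "x \<in> (\<lambda>y. t *\<^sub>R y) ` L"
    using dilate_mono[of s t x] by auto
qed

lemma gauge_nonneg: "x \<in> F \<Longrightarrow> 0 \<le> gauge_norm L x"
  unfolding gauge_norm_def using gauge_set_nonempty by (intro cInf_greatest) auto

lemma gauge_add:
  assumes "x \<in> F" "y \<in> F"
  shows "gauge_norm L (x + y) \<le> gauge_norm L x + gauge_norm L y"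
proof (rule field_le_epsilon)
  fix e :: real assume "0 < e"
  define t where "t = gauge_norm L x + e / 2"
  define t' where "t' = gauge_norm L y + e / 2"
  have t: "0 < t" "x \<in> (\<lambda>y. t *\<^sub>R y) ` L" and t': "0 < t'" "y \<in> (\<lambda>y. t' *\<^sub>R y) ` L"
    using gauge_less_mem[OF assms(1), of t] gauge_less_mem[OF assms(2), of t'] \<open>0 < e\<close>
    by (simp_all add: t_def t'_def)
  obtain u v where uv: "u \<in> L" "v \<in> L" "x = t *\<^sub>R u" "y = t' *\<^sub>R v"
    using t(2) t'(2) by blast
  have "(t / (t + t')) *\<^sub>R u + (t' / (t + t')) *\<^sub>R v \<in> L"
    using uv t(1) t'(1) convex_L by (intro convexD) (auto simp: add_divide_distrib[symmetric])
  moreover have "x + y = (t + t') *\<^sub>R ((t / (t + t')) *\<^sub>R u + (t' / (t + t')) *\<^sub>R v)"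
    using uv t(1) t'(1) by (simp add: scaleR_add_right)
  ultimately have "gauge_norm L (x + y) \<le> t + t'"
    using t(1) t'(1) by (intro gauge_le) auto
  then show "gauge_norm L (x + y) \<le> gauge_norm L x + gauge_norm L y + e"
    by (simp add: t_def t'_def)
qed

lemma gauge_scale_le:
  assumes "x \<in> F" "0 < c"
  shows "gauge_norm L (c *\<^sub>R x) \<le> c * gauge_norm L x"
proof -
  have "gauge_norm L (c *\<^sub>R x) / c \<le> t" if "gauge_norm L x < t" for t
  proof -
    have "0 < t" "x \<in> (\<lambda>y. t *\<^sub>R y) ` L"
      using gauge_less_mem[OF assms(1) that] by auto
    then have "gauge_norm L (c *\<^sub>R x) \<le> c * t"
      using assms(2) by (intro gauge_le) auto
    then show ?thesis using assms(2) by (simp add: field_simps)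
  qed
  then have "gauge_norm L (c *\<^sub>R x) / c \<le> gauge_norm L x"
    by (rule dense_ge)
  then show ?thesis using assms(2) by (simp add: field_simps)
qed

lemma gauge_scale:
  assumes "x \<in> F" "0 < c"
  shows "gauge_norm L (c *\<^sub>R x) = c * gauge_norm L x"
proof (rule antisym[OF gauge_scale_le[OF assms]])
  have "gauge_norm L x \<le> 1 / c * gauge_norm L (c *\<^sub>R x)"
    using gauge_scale_le[of "c *\<^sub>R x" "1 / c"] assms F by (simp add: subspace_scale)
  then show "c * gauge_norm L x \<le> gauge_norm L (c *\<^sub>R x)"
    using assms(2) by (simp add: field_simps)
qed

lemma gauge_le_b_const:
  assumes "x \<in> F"
  shows "gauge_norm L x \<le> b_const F L * norm x"
proof (cases "x = 0")
  case True
  have "gauge_norm L 0 \<le> t" if "0 < t" for t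
    using subspace_0[OF F] r that by (intro gauge_le ball_dilate_mem) auto
  then have "gauge_norm L 0 \<le> 0" by (rule dense_ge)
  then show ?thesis using True by simp
next
  case False
  have "bdd_above (gauge_norm L ` {x \<in> F. norm x = 1})"
    using r by (intro bdd_aboveI2[of _ _ "1 / r"]) (auto intro!: gauge_le ball_dilate_mem)
  moreover have "(1 / norm x) *\<^sub>R x \<in> {x \<in> F. norm x = 1}"
    using assms False F by (auto simp: subspace_scale)
  ultimately have "gauge_norm L ((1 / norm x) *\<^sub>R x) \<le> b_const F L"
    unfolding b_const_def by (rule cSUP_upper[rotated])
  moreover have "gauge_norm L ((1 / norm x) *\<^sub>R x) = 1 / norm x * gauge_norm L x"
    using assms False by (intro gauge_scale) auto
  ultimately show ?thesis
    using False by (simp add: field_simps)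
qed

lemma gauge_add_closest_point:
  "gauge_norm L (closest_point F (x + y)) \<le> gauge_norm L (closest_point F x) + gauge_norm L (closest_point F y)"
  unfolding linear_add[OF linear_closest_point[OF F]]
  by (rule gauge_add[OF closest_point_subspace_mem[OF F] closest_point_subspace_mem[OF F]])

lemma gauge_scale_closest_point:
  "0 < c \<Longrightarrow> gauge_norm L (closest_point F (c *\<^sub>R x)) = c * gauge_norm L (closest_point F x)"
  unfolding linear_cmul[OF linear_closest_point[OF F]]
  by (rule gauge_scale[OF closest_point_subspace_mem[OF F]])

lemma gauge_closest_point_le:
  "gauge_norm L (closest_point F x) \<le> \<bar>b_const F L\<bar> * norm x"
proof -
  have "closest_point F 0 = 0"
    using F by (simp add: linear_0 linear_closest_point)
  then have "norm (closest_point F x) \<le> norm x"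
    using closest_point_lipschitz[OF subspace_imp_convex[OF F] closed_subspace[OF F], of x 0] subspace_0[OF F]
    by auto
  then have "\<bar>b_const F L\<bar> * norm (closest_point F x) \<le> \<bar>b_const F L\<bar> * norm x"
    by (rule mult_left_mono) simp
  moreover have "gauge_norm L (closest_point F x) \<le> \<bar>b_const F L\<bar> * norm (closest_point F x)"
    using gauge_le_b_const[OF closest_point_subspace_mem[OF F]]
    by (rule order_trans) (simp add: mult_right_mono)
  ultimately show ?thesis by linarith
qed

lemma gauge_closest_point_measurable:
  "(\<lambda>x. gauge_norm L (closest_point F x)) \<in> borel_measurable borel"
  by (rule borel_measurable_continuous_onI)
     (rule sublinear_continuous[OF gauge_add_closest_point gauge_closest_point_le])

text \<open>
  The gauge is Borel on the whole space: off F it is the infimum of the empty set, which is a constant.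
\<close>

lemma ell_eq_integral: "ell F L = (\<integral>x. gauge_norm L (closest_point F x) \<partial>gaussian)"
proof -
  have "x \<notin> (\<lambda>y. t *\<^sub>R y) ` L" if "x \<notin> F" for x t
    using that L_F F by (auto simp: subspace_scale subset_iff)
  then have eq: "gauge_norm L = (\<lambda>x. if x \<in> F then gauge_norm L (closest_point F x) else Inf {})"
    by (auto simp: fun_eq_iff closest_point_self gauge_norm_def)
  have "gauge_norm L \<in> borel_measurable borel"
    by (subst eq, rule measurable_If_set[OF gauge_closest_point_measurable borel_measurable_const])
       (use closed_subspace[OF F] in simp)
  moreover have "closest_point F \<in> borel_measurable gaussian"
    using linear_borel_measurable[OF linear_closest_point[OF F]]
    by (simp cong: measurable_cong_sets)
  ultimately show ?thesis
    unfolding ell_def std_gaussian_eq_distr[OF F] by (intro integral_distr)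
qed

lemma ell_nonneg: "0 \<le> ell F L"
  unfolding ell_eq_integral
  by (intro Bochner_Integration.integral_nonneg gauge_nonneg closest_point_subspace_mem F)

text \<open>
  The gauge composed with the projection is sublinear, and its Lipschitz constant is the maximum of
  the gauge on the unit sphere of F.
\<close>

lemma gauge_tail:
  assumes "b_const F L \<noteq> 0" "ell F L \<le> t"
  shows "measure gaussian {x. t < gauge_norm L (closest_point F x)}
    \<le> exp (- (2 * (t - ell F L)\<^sup>2 / (pi\<^sup>2 * (b_const F L)\<^sup>2)))"
  using assms gaussian_sublinear_tail[where f = "\<lambda>x. gauge_norm L (closest_point F x)"
      and b = "\<bar>b_const F L\<bar>" and t = t,
      OF gauge_nonneg[OF closest_point_subspace_mem[OF F]]
        gauge_add_closest_point gauge_scale_closest_point gauge_closest_point_le]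
  by (simp add: ell_eq_integral[symmetric])

end

text \<open>
  Markov's inequality for \<open>exp (- |P x|\<^sup>2 / 2)\<close>, whose mean is at most \<open>2 powr (- n / 2)\<close>. The radius is chosen
  so that \<open>(129/200)\<^sup>2 / 2 - ln 2 / 2 \<le> - 1 / 8\<close> follows from \<open>ln 2 \<ge> 2 / 3\<close>.
\<close>

lemma gaussian_small_ball:
  fixes F :: "'a::euclidean_space set"
  assumes F: "subspace F" and n: "n \<le> dim F"
  shows "measure gaussian {x. norm (closest_point F x) \<le> (129/200) * sqrt (real n)} \<le> exp (- real n / 8)"
proof -
  define S where "S = {x. norm (closest_point F x) \<le> (129/200) * sqrt (real n)}"
  define q where "q = (129/200) * (129/200) * real n / 2"
  have [measurable]: "closest_point F \<in> borel_measurable borel"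
    by (intro linear_borel_measurable linear_closest_point F)
  have "ennreal (measure gaussian S * exp (- q))
    = (\<integral>\<^sup>+x. ennreal (exp (- q)) * indicator S x \<partial>gaussian)"
    by (simp add: nn_integral_cmult S_def gaussian.emeasure_eq_measure ennreal_mult mult.commute)
  also have "\<dots> \<le> (\<integral>\<^sup>+x. ennreal (exp (- (norm (closest_point F x))\<^sup>2 / 2)) \<partial>gaussian)"
  proof (rule nn_integral_mono)
    fix x
    have "(norm (closest_point F x))\<^sup>2 / 2 \<le> q" if "x \<in> S"
    proof -
      have "(norm (closest_point F x))\<^sup>2 \<le> ((129/200) * sqrt (real n))\<^sup>2"
        using that unfolding S_def mem_Collect_eq by (rule power_mono) simp
      also have "\<dots> = 2 * q"
        by (simp add: q_def power_mult_distrib power2_eq_square)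
      finally show ?thesis by simp
    qed
    then show "ennreal (exp (- q)) * indicator S x \<le> ennreal (exp (- (norm (closest_point F x))\<^sup>2 / 2))"
      by (cases "x \<in> S") (simp_all add: ennreal_leI)
  qed
  also have "\<dots> = ennreal ((1 / sqrt 2) ^ dim F)"
    by (rule gaussian_small_ball_mgf[OF F])
  finally have "measure gaussian S * exp (- q) \<le> (1 / sqrt 2) ^ dim F"
    by (simp add: ennreal_le_iff)
  also have "(1 / sqrt 2 :: real) ^ dim F \<le> (1 / sqrt 2) ^ n"
    using n by (intro power_decreasing) auto
  also have "1 / sqrt 2 = exp (- (ln 2 / 2 :: real))"
    by (simp add: ln_sqrt[symmetric] exp_minus inverse_eq_divide)
  also have "exp (- (ln 2 / 2)) ^ n = exp (- (real n * (ln 2 / 2)))"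
    by (simp add: exp_of_nat_mult[symmetric])
  finally have "measure gaussian S \<le> exp (- (real n * (ln 2 / 2))) / exp (- q)"
    by (simp add: pos_le_divide_eq)
  also have "\<dots> = exp (q - real n * (ln 2 / 2))"
    by (simp add: exp_diff[symmetric])
  also have "\<dots> \<le> exp (- real n / 8)"
  proof -
    have "real n * (2 / 3 / 2) \<le> real n * (ln 2 / 2)"
      using ln2_ge_two_thirds by (intro mult_left_mono) auto
    then show ?thesis by (simp add: q_def)
  qed
  finally show ?thesis by (simp add: S_def)
qed

lemma section_radius_ge_iff:
  fixes K E :: "'a::euclidean_space set"
  assumes K: "compact K" "0 \<in> K" and E: "subspace E"
  shows "c \<le> section_radius K E \<longleftrightarrow> (\<exists>y\<in>K. c \<le> norm y \<and> y \<in> E)"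
proof -
  have "compact (E \<inter> K)"
    using K(1) closed_subspace[OF E] by (simp add: closed_Int_compact)
  moreover have "E \<inter> K \<noteq> {}"
    using K(2) subspace_0[OF E] by blast
  ultimately obtain y where y: "y \<in> E \<inter> K" "\<And>z. z \<in> E \<inter> K \<Longrightarrow> norm z \<le> norm y"
    using continuous_attains_sup[of "E \<inter> K" norm] continuous_on_norm_id by blast
  then have "section_radius K E = norm y"
    unfolding section_radius_def by (intro cSup_eq_maximum) auto
  then show ?thesis
    using y by (auto intro: order_trans)
qed

text \<open>
  The radius is upper semicontinuous in E: the matrices fixing some point of K of norm at least c form
  a closed set, as the projection of a closed set along the compact K.
\<close>

lemma section_radius_ge_measurable:
  fixes K :: "(real^'n) set" and \<mu> :: "(real^'n) set measure"
  assumes K: "compact K" "0 \<in> K" and mu: "sets \<mu> = sets (grassmannian_borel k)"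
  shows "{E \<in> space \<mu>. c \<le> section_radius K E} \<in> sets \<mu>"
proof -
  define D where "D = {M::real^'n^'n. \<exists>y\<in>K. c \<le> norm y \<and> M *v y = y}"
  have sp: "space \<mu> = grassmannian k"
    using sets_eq_imp_space_eq[OF mu] by simp
  have cont: "continuous_on UNIV (\<lambda>p::(real^'n) \<times> (real^'n^'n). snd p *v fst p)"
    unfolding matrix_vector_mult_def by (intro continuous_intros)
  have "closed {p::(real^'n) \<times> (real^'n^'n). c \<le> norm (fst p) \<and> snd p *v fst p = fst p}"
    by (intro closed_Collect_conj closed_Collect_le closed_Collect_eq cont continuous_intros)
  then have "closed {M. \<exists>y. y \<in> K \<and> (y, M) \<in> {p. c \<le> norm (fst p) \<and> snd p *v fst p = fst p}}"
    by (rule closed_compact_projection[OF K(1)])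
  then have "closed D"
    by (simp add: D_def Bex_def)
  then have "(\<lambda>E. matrix (closest_point E)) -` D \<inter> space (grassmannian_borel k) \<in> sets (grassmannian_borel k)"
    by (intro measurable_sets[OF matrix_closest_point_measurable]) simp
  moreover have "c \<le> section_radius K E \<longleftrightarrow> matrix (closest_point E) \<in> D" if "E \<in> grassmannian k" for E
  proof -
    have E: "subspace E" using that by (simp add: grassmannian_def)
    then have "E \<noteq> {}" using subspace_0 by blast
    then have "closest_point E y = y \<longleftrightarrow> y \<in> E" for y
      using closed_subspace[OF E] by (rule closest_point_refl[rotated])
    then show ?thesis
      unfolding section_radius_ge_iff[OF K E] D_def by (simp add: matrix_closest_point[OF E])
  qed
  then have "{E \<in> space \<mu>. c \<le> section_radius K E}
    = (\<lambda>E. matrix (closest_point E)) -` D \<inter> space (grassmannian_borel k)"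
    by (auto simp: sp)
  ultimately show ?thesis by (simp add: mu)
qed

text \<open>
  Here w is a multiple of a point of K and close to its projection p to E. The error p - w is a multiple
  of a point of the ball of radius r, so p itself is a multiple of a point of K, with a slightly larger
  factor than w.
\<close>

lemma section_radius_ge_of_close_point:
  fixes K E :: "'a::euclidean_space set"
  assumes K: "compact K" "convex K" "cball 0 r \<subseteq> K" and r: "0 < r" and E: "subspace E"
    and y: "y \<in> K" "0 < t" and w: "w = t *\<^sub>R y" and \<delta>: "0 < \<delta>"
    and close: "norm (w - closest_point E w) < \<delta> * norm w"
    and \<rho>: "\<rho> * (t + \<delta> * norm w / r) \<le> (1 - \<delta>) * norm w"
  shows "\<rho> \<le> section_radius K E"
proof -
  define p where "p = closest_point E w"
  have "0 < \<delta> * norm w"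
    using close norm_ge_zero[of "w - closest_point E w"] by linarith
  define t2 where "t2 = \<delta> * norm w / r"
  have t2: "0 < t2" using \<open>0 < \<delta> * norm w\<close> r by (simp add: t2_def)
  define y2 where "y2 = (1 / t2) *\<^sub>R (p - w)"
  have "norm (p - w) \<le> t2 * r"
    using close r by (simp add: t2_def p_def norm_minus_commute)
  then have "norm y2 \<le> r"
    using t2 by (simp add: y2_def pos_divide_le_eq mult.commute)
  then have "y2 \<in> K" using K(3) by auto
  then have z: "(t / (t + t2)) *\<^sub>R y + (t2 / (t + t2)) *\<^sub>R y2 \<in> K"
    using y t2 K(2) by (intro convexD) (auto simp: add_divide_distrib[symmetric])
  have "(t / (t + t2)) *\<^sub>R y + (t2 / (t + t2)) *\<^sub>R y2 = (1 / (t + t2)) *\<^sub>R (t *\<^sub>R y + t2 *\<^sub>R y2)"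
    by (simp add: scaleR_add_right)
  also have "t *\<^sub>R y + t2 *\<^sub>R y2 = p"
    using t2 by (simp add: w[symmetric] y2_def)
  finally have z_eq: "(t / (t + t2)) *\<^sub>R y + (t2 / (t + t2)) *\<^sub>R y2 = (1 / (t + t2)) *\<^sub>R p" .
  have "norm w - norm (w - p) \<le> norm p"
    using norm_triangle_ineq2[of w "w - p"] by simp
  then have "(1 - \<delta>) * norm w \<le> norm p"
    using close by (simp add: p_def algebra_simps)
  then have "\<rho> * (t + t2) \<le> norm p"
    using \<rho> by (simp add: t2_def)
  then have "\<rho> \<le> norm ((1 / (t + t2)) *\<^sub>R p)"
    using y(2) t2 by (simp add: field_simps)
  moreover have "(1 / (t + t2)) *\<^sub>R p \<in> E"
    using E closest_point_subspace_mem[OF E] by (simp add: p_def subspace_scale)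
  moreover have "(1 / (t + t2)) *\<^sub>R p \<in> K"
    using z by (simp only: z_eq)
  moreover have "0 \<in> K" using K(3) r by auto
  ultimately show ?thesis
    unfolding section_radius_ge_iff[OF K(1) \<open>0 \<in> K\<close> E] by blast
qed

text \<open>
  The event B that the Gaussian vector has a projection w to F with \<open>\<rho>' * gauge w < |w|\<close>, for \<rho>' slightly
  larger than the radius \<rho> in question, implies that the section by any E close to w has radius at
  least \<rho>. It fails only on the small ball event S or on the upper tail U of the gauge.
\<close>

theorem corollary1p6:
  fixes K F :: "(real^'N) set" and \<mu> :: "(real^'N) set measure" and n :: nat and s :: real
  assumes "1 \<le> n" and "n < CARD('N)"
    and "convex_body K"
    and "haar_grassmannian (CARD('N) - n) \<mu>"
    and "subspace F" and "dim F = n + 1"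
    and "1 \<le> s"
  shows "measure \<mu> {E \<in> space \<mu>. section_radius K E \<ge> sqrt (real n) / (4 * s * ell F (K \<inter> F))}
    \<ge> 1 - exp (- real n / 8)
        - exp (- (s\<^sup>2 * (ell F (K \<inter> F))\<^sup>2 / (2 * (b_const F (K \<inter> F))\<^sup>2)))"
proof -
  have K: "compact K" "convex K" "0 \<in> interior K"
    using assms(3) by (auto simp: convex_body_def)
  then obtain r where r_pos: "0 < r" and r_K: "cball 0 r \<subseteq> K"
    using mem_interior_cball by blast
  then have "0 \<in> K" by auto
  interpret relative_convex_body F "K \<inter> F" r
    using assms(5) K(2) r_pos r_K by unfold_locales (auto intro: convex_Int subspace_imp_convex)
  define l where "l = ell F (K \<inter> F)"
  define b where "b = b_const F (K \<inter> F)"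
  define \<rho> where "\<rho> = sqrt (real n) / (4 * s * l)"
  define A where "A = {E \<in> space \<mu>. \<rho> \<le> section_radius K E}"
  define f where "f x = gauge_norm (K \<inter> F) (closest_point F x)" for x
  have "1 - exp (- real n / 8) - exp (- (s\<^sup>2 * l\<^sup>2 / (2 * b\<^sup>2))) \<le> measure \<mu> A"
  proof (cases "l = 0 \<or> b = 0")
    case True
    \<comment> \<open>The value of the quotient is 0 in this case, and the lower bound is not positive.\<close>
    then have exp_eq_1: "exp (- (s\<^sup>2 * l\<^sup>2 / (2 * b\<^sup>2))) = 1" by auto
    have "1 - exp (- real n / 8) - exp (- (s\<^sup>2 * l\<^sup>2 / (2 * b\<^sup>2))) \<le> 0"
      unfolding exp_eq_1 by simp
    then show ?thesis using measure_nonneg[of \<mu> A] by linarith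
  next
    case False
    then have l_pos: "0 < l" and b: "b \<noteq> 0"
      using ell_nonneg by (auto simp: l_def less_le)
    have s: "0 < s" using assms(7) by simp
    have \<rho>: "0 < \<rho>" using l_pos s assms(1) by (simp add: \<rho>_def)
    define \<rho>' where "\<rho>' = (1001/1000) * \<rho>"
    have \<rho>': "0 < \<rho>'" using \<rho> by (simp add: \<rho>'_def)
    \<comment> \<open>The largest \<delta> for which the gain \<rho>' / \<rho> pays for the angular error.\<close>
    define \<delta> where "\<delta> = (1 - 1000/1001) / (1 + \<rho> / r)"
    have \<delta>: "0 < \<delta>" using \<rho> r by (simp add: \<delta>_def add_pos_pos)
    define B where "B = {x. \<rho>' * f x < norm (closest_point F x)}"
    have f_meas [measurable]: "f \<in> borel_measurable borel"
      unfolding f_def[abs_def] by (rule gauge_closest_point_measurable)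
    have P_meas [measurable]: "closest_point F \<in> borel_measurable borel"
      by (rule linear_borel_measurable[OF linear_closest_point[OF F]])
    have f_nonneg: "0 \<le> f x" for x
      unfolding f_def by (rule gauge_nonneg[OF closest_point_subspace_mem[OF F]])
    have B: "B \<in> sets borel" unfolding B_def by measurable
    have norm_pos: "0 < norm (closest_point F x)" if "x \<in> B" for x
      using that mult_nonneg_nonneg[OF less_imp_le[OF \<rho>'] f_nonneg[of x]]
      unfolding B_def mem_Collect_eq by linarith
    have "measure gaussian B \<le> measure \<mu> A"
    proof (rule haar_grassmannian_ge_gaussian[OF assms(4) F _ \<delta> B])
      show "CARD('N) < CARD('N) - n + dim F"
        using assms(2,6) by simp
      show "A \<in> sets \<mu>"
        unfolding A_def using assms(4) \<open>0 \<in> K\<close>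
        by (intro section_radius_ge_measurable K(1)) (auto simp: haar_grassmannian_def)
      show "closest_point F x \<noteq> 0" if "x \<in> B" for x
        using norm_pos[OF that] by simp
      fix E x
      assume E: "E \<in> grassmannian (CARD('N) - n)" and x: "x \<in> B"
        and close: "norm (closest_point F x - closest_point E (closest_point F x)) < \<delta> * norm (closest_point F x)"
      define w where "w = closest_point F x"
      define t where "t = norm w / \<rho>'"
      have "w \<in> F" unfolding w_def by (rule closest_point_subspace_mem[OF F])
      moreover have "gauge_norm (K \<inter> F) w < t"
        using x \<rho>' by (simp add: B_def f_def w_def t_def field_simps)
      ultimately have "0 < t" "w \<in> (\<lambda>y. t *\<^sub>R y) ` (K \<inter> F)"
        by (rule gauge_less_mem)+
      then obtain y where y: "y \<in> K" "w = t *\<^sub>R y" by blast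
      have "\<delta> * (1 + \<rho> / r) = 1 - 1000/1001"
        using \<rho> r by (simp add: \<delta>_def add_pos_pos less_imp_neq[symmetric])
      moreover have "\<delta> * (1 + \<rho> / r) = \<delta> + \<rho> * \<delta> / r"
        by (simp add: distrib_left mult.commute)
      ultimately have coeff: "1000/1001 + \<rho> * \<delta> / r = 1 - \<delta>"
        by linarith
      have "\<rho> * (t + \<delta> * norm w / r) = \<rho> * t + \<rho> * \<delta> / r * norm w"
        by (simp add: distrib_left)
      also have "\<rho> * t = 1000/1001 * norm w"
        using \<rho> by (simp add: t_def \<rho>'_def)
      also have "1000/1001 * norm w + \<rho> * \<delta> / r * norm w = (1 - \<delta>) * norm w"
        by (simp only: coeff[symmetric] distrib_right)
      finally have "\<rho> * (t + \<delta> * norm w / r) = (1 - \<delta>) * norm w" .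
      then have "\<rho> \<le> section_radius K E"
        using E close by (intro section_radius_ge_of_close_point[OF K(1,2) r_K r_pos _ y(1) \<open>0 < t\<close> y(2) \<delta>])
          (auto simp: grassmannian_def w_def)
      moreover have "E \<in> space \<mu>"
        using E assms(4) sets_eq_imp_space_eq space_grassmannian_borel
        unfolding haar_grassmannian_def by metis
      ultimately show "E \<in> A" by (simp add: A_def)
    qed
    moreover have "1 - exp (- real n / 8) - exp (- (s\<^sup>2 * l\<^sup>2 / (2 * b\<^sup>2))) \<le> measure gaussian B"
    proof -
      define S where "S = {x. norm (closest_point F x) \<le> (129/200) * sqrt (real n)}"
      define U where "U = {x. (103/40) * s * l < f x}"
      have [measurable]: "S \<in> sets borel" "U \<in> sets borel"
        unfolding S_def U_def by measurable
      have cover: "UNIV \<subseteq> B \<union> (S \<union> U)"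
      proof
        fix x
        show "x \<in> B \<union> (S \<union> U)"
        proof (cases "x \<in> B \<or> x \<in> S")
          case False
          then have "(129/200) * sqrt (real n) < \<rho>' * f x"
            by (auto simp: B_def S_def)
          also have "\<rho>' = (1001/1000) * sqrt (real n) / (4 * s * l)"
            by (simp add: \<rho>'_def \<rho>_def)
          finally have "sqrt (real n) * ((129/50) * (s * l)) < sqrt (real n) * ((1001/1000) * f x)"
            using s l_pos by (simp add: field_simps)
          then have "(129/50) * (s * l) < (1001/1000) * f x"
            using assms(1) by (simp add: mult_less_cancel_left_pos)
          moreover have "0 < s * l" using s l_pos by simp
          ultimately have "(103/40) * (s * l) < f x" by linarith
          then show ?thesis by (simp add: U_def mult.assoc)
        qed auto
      qed
      have "1 = measure gaussian (UNIV :: (real^'N) set)"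
        using gaussian.prob_space[where ?'a = "real^'N"] by simp
      also have "\<dots> \<le> measure gaussian (B \<union> (S \<union> U))"
        using cover B by (intro gaussian.finite_measure_mono) auto
      also have "\<dots> \<le> measure gaussian B + (measure gaussian S + measure gaussian U)"
        using B by (intro order_trans[OF measure_Un_le] add_mono measure_Un_le order_refl) auto
      finally have "1 \<le> measure gaussian B + (measure gaussian S + measure gaussian U)" .
      moreover have "measure gaussian S \<le> exp (- real n / 8)"
        unfolding S_def using assms(6) by (intro gaussian_small_ball F) simp
      moreover have "measure gaussian U \<le> exp (- (s\<^sup>2 * l\<^sup>2 / (2 * b\<^sup>2)))"
      proof -
        have "l \<le> s * l" using assms(7) l_pos by simp
        \<comment> \<open>With \<open>s \<ge> 1\<close>, the excess over the mean is at least \<open>(63/40) * s * l\<close>, and \<open>63/40 \<ge> pi / 2\<close>.\<close>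
        have "measure gaussian U \<le> exp (- (2 * ((103/40) * s * l - l)\<^sup>2 / (pi\<^sup>2 * b\<^sup>2)))"
          unfolding U_def f_def b_def l_def
          using b \<open>l \<le> s * l\<close> l_pos s
          by (intro gauge_tail) (auto simp: b_def l_def)
        moreover have "s\<^sup>2 * l\<^sup>2 / (2 * b\<^sup>2) \<le> 2 * ((103/40) * s * l - l)\<^sup>2 / (pi\<^sup>2 * b\<^sup>2)"
        proof -
          have "pi \<le> (63/20)" using pi_approx by simp
          then have "pi * (s * l) \<le> (63/20) * (s * l)"
            using s l_pos by (intro mult_right_mono) auto
          also have "\<dots> \<le> 2 * ((103/40) * s * l - l)"
            using \<open>l \<le> s * l\<close> by (simp add: algebra_simps)
          finally have "(pi * (s * l))\<^sup>2 \<le> (2 * ((103/40) * s * l - l))\<^sup>2"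
            using s l_pos by (intro power_mono) auto
          then have "pi\<^sup>2 * (s\<^sup>2 * l\<^sup>2) \<le> 4 * ((103/40) * s * l - l)\<^sup>2"
            by (simp only: power_mult_distrib) simp
          then have "pi\<^sup>2 * (s\<^sup>2 * l\<^sup>2) / (2 * pi\<^sup>2 * b\<^sup>2) \<le> 4 * ((103/40) * s * l - l)\<^sup>2 / (2 * pi\<^sup>2 * b\<^sup>2)"
            by (rule divide_right_mono) simp
          then show ?thesis using b by simp
        qed
        ultimately show ?thesis by (elim order_trans) simp
      qed
      ultimately show ?thesis by linarith
    qed
    ultimately show ?thesis by linarith
  qed
  then show ?thesis
    by (simp only: A_def \<rho>_def l_def b_def)
qed

end
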